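(* Let $\alpha\in\mathbb{R}$. Up to a linear isometry and a dilation of $\mathbb{L}^2$, the $\alpha$-stationary spacelike curves contained in $\mathcal{C}^+$ are parametrized by $\gamma(s)=\rho(s)(\cosh s,\sinh s)$, where $$\rho(s)=\begin{cases}\sinh((\alpha+1)s)^{\frac{-1}{\alpha+1}}, & \alpha\neq -1,\\ e^{cs}, & \alpha=-1,\ c^2>1\ (c\in\mathbb{R}\text{ constant}).\end{cases}$$ Moreover: (1) If $\alpha>0$, then a branch of $\gamma$ touches $\mathcal{C}$ orthogonally and the other one is asymptotic to the $x$-axis. (2) If $-1<\alpha<0$, then a branch of $\gamma$ goes to $\mathcal{C}$ tangentially. (3) If $\alpha=-1$, then a branch of $\gamma$ goes to $(0,0)$ and tangentially to $\mathcal{C}$. (4) If $\alpha<-1$, then a branch of $\gamma$ goes to $(0,0)$ tangentially to the $x$-axis and the other branch is asymptotic to a translation of the lightlike cone $\mathcal{C}$.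
   Context: $\mathbb{L}^2=(\mathbb{R}^2,\langle\cdot,\cdot\rangle)$ with $\langle\cdot,\cdot\rangle=dx^2-dy^2$. $\mathcal{C}=\{p\in\mathbb{L}^2:\langle p,p\rangle=0\}$ is the lightlike cone and $\mathcal{C}^+=\{p:\langle p,p\rangle>0\}$. A smooth regular curve is spacelike (resp. timelike) if $\langle\gamma',\gamma'\rangle>0$ (resp. $<0$) everywhere. Let $N$ be a unit normal field along $\gamma$ ($\langle N,\gamma'\rangle=0$, $|\langle N,N\rangle|=1$). When $\gamma$ is parametrized by arc-length ($|\langle\gamma',\gamma'\rangle|=1$) its curvature is $\kappa=-\langle N,\gamma''\rangle$. A spacelike or timelike curve $\gamma\colon I\to\mathbb{L}^2$ with $\gamma(I)\cap\mathcal{C}=\emptyset$ is called $\alpha$-stationary if $\kappa=-\alpha\,\dfrac{\langle N,\gamma\rangle}{|\langle\gamma,\gamma\rangle|}$ along $\gamma$ (this condition does not depend on the choice of sign of $N$). A dilation is a map $p\mapsto\lambda p$, $\lambda>0$. Curves are considered on their maximal domain: $\{s:(\alpha+1)s>0\}$ if $\alpha\ne-1$, and $\mathbb{R}$ if $\alpha=-1$. A branch of $\gamma$ is one of its two ends (as $s$ tends to an endpoint of the domain). A branch is asymptotic to a line if it goes to infinity approaching that line; it is asymptotic to a translation of $\mathcal{C}$ if it is asymptotic to one of the two lines forming the translated cone. "Touches/goes to $\mathcal{C}$" is understood in the limit: $\gamma(s)$ tends to a point of $\mathcal{C}$, which is not the origin unless said otherwise, and the contact is tangential (resp. orthogonal)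 if the limit of the tangent direction is that of a line of $\mathcal{C}$ through the limit point (resp. is perpendicular to it in the Euclidean sense).
   Formalization: The classification excludes curves contained in a straight line through the origin: such spacelike lines in C^+ (e.g. the positive x-axis) are α-stationary for every α but are never of the form ρ(s)(cosh s, sinh s). *)

theory Defs
  imports "HOL-Analysis.Analysis"
begin

section \<open>The Lorentzian plane\<close>

text \<open>
  The underlying vector space is \<^typ>\<open>real \<times> real\<close>. The library norm, inner product and topology
  on it are the Euclidean ones; the Lorentzian metric \<open>dx\<^sup>2 - dy\<^sup>2\<close> is \<open>lor\<close>.
\<close>

definition lor :: "real \<times> real \<Rightarrow> real \<times> real \<Rightarrow> real" where
  "lor p q = fst p * fst q - snd p * snd q"

definition light_cone :: "(real \<times> real) set" where
  "light_cone = {p. lor p p = 0}"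

definition cone_plus :: "(real \<times> real) set" where
  "cone_plus = {p. lor p p > 0}"

definition cone_lines :: "(real \<times> real) set set" where
  "cone_lines = {{p. fst p = snd p}, {p. fst p = - snd p}}"

lemma light_cone_eq_Union_cone_lines: "light_cone = \<Union> cone_lines"
  by (auto simp: light_cone_def cone_lines_def lor_def square_eq_iff)

definition x_axis :: "(real \<times> real) set" where
  "x_axis = {p. snd p = 0}"

definition linear_isometry :: "(real \<times> real \<Rightarrow> real \<times> real) \<Rightarrow> bool" where
  "linear_isometry A \<longleftrightarrow> linear A \<and> (\<forall>p q. lor (A p) (A q) = lor p q)"

definition dilation :: "(real \<times> real \<Rightarrow> real \<times> real) \<Rightarrow> bool" where
  "dilation d \<longleftrightarrow> (\<exists>r>0. d = (\<lambda>p. r *\<^sub>R p))"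

section \<open>Curves\<close>

definition open_interval :: "real set \<Rightarrow> bool" where
  "open_interval I \<longleftrightarrow> open I \<and> is_interval I \<and> I \<noteq> {}"

definition velocity :: "(real \<Rightarrow> 'a::real_normed_vector) \<Rightarrow> real \<Rightarrow> 'a" where
  "velocity f = (\<lambda>t. vector_derivative f (at t))"

text \<open>
  Being of class \<open>C\<^sup>\<infinity>\<close>; meant for open sets \<open>I\<close>, on which the values of the iterated derivatives
  depend only on the restriction of \<open>f\<close> to \<open>I\<close>.
\<close>

definition smooth_curve_on :: "(real \<Rightarrow> 'a::real_normed_vector) \<Rightarrow> real set \<Rightarrow> bool" where
  "smooth_curve_on f I \<longleftrightarrow> (\<forall>n. \<forall>t\<in>I. (velocity ^^ n) f differentiable (at t))"

definition regular_curve :: "(real \<Rightarrow> real \<times> real) \<Rightarrow> real set \<Rightarrow> bool" where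
  "regular_curve \<gamma> I \<longleftrightarrow>
     open_interval I \<and> smooth_curve_on \<gamma> I \<and> (\<forall>t\<in>I. velocity \<gamma> t \<noteq> 0)"

definition spacelike_curve :: "(real \<Rightarrow> real \<times> real) \<Rightarrow> real set \<Rightarrow> bool" where
  "spacelike_curve \<gamma> I \<longleftrightarrow>
     regular_curve \<gamma> I \<and> (\<forall>t\<in>I. lor (velocity \<gamma> t) (velocity \<gamma> t) > 0)"

definition timelike_curve :: "(real \<Rightarrow> real \<times> real) \<Rightarrow> real set \<Rightarrow> bool" where
  "timelike_curve \<gamma> I \<longleftrightarrow>
     regular_curve \<gamma> I \<and> (\<forall>t\<in>I. lor (velocity \<gamma> t) (velocity \<gamma> t) < 0)"

text \<open>\<open>h\<close> maps the open interval \<open>J\<close> diffeomorphically onto \<open>I\<close>; it may reverse orientation.\<close>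

definition change_of_parameter :: "(real \<Rightarrow> real) \<Rightarrow> real set \<Rightarrow> real set \<Rightarrow> bool" where
  "change_of_parameter h J I \<longleftrightarrow>
     open_interval J \<and> smooth_curve_on h J \<and> (\<forall>s\<in>J. velocity h s \<noteq> 0) \<and> h ` J = I"

definition arclength_parametrized :: "(real \<Rightarrow> real \<times> real) \<Rightarrow> real set \<Rightarrow> bool" where
  "arclength_parametrized \<gamma> I \<longleftrightarrow> (\<forall>s\<in>I. \<bar>lor (velocity \<gamma> s) (velocity \<gamma> s)\<bar> = 1)"

definition unit_normal_field ::
    "(real \<Rightarrow> real \<times> real) \<Rightarrow> (real \<Rightarrow> real \<times> real) \<Rightarrow> real set \<Rightarrow> bool" where
  "unit_normal_field N \<gamma> I \<longleftrightarrow> smooth_curve_on N I \<and>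
     (\<forall>s\<in>I. lor (N s) (velocity \<gamma> s) = 0 \<and> \<bar>lor (N s) (N s)\<bar> = 1)"

text \<open>Only meaningful as a curvature when \<open>\<gamma>\<close> is parametrized by arc-length.\<close>

definition arclength_curvature ::
    "(real \<Rightarrow> real \<times> real) \<Rightarrow> (real \<Rightarrow> real \<times> real) \<Rightarrow> real \<Rightarrow> real" where
  "arclength_curvature N \<gamma> s = - lor (N s) (velocity (velocity \<gamma>) s)"

definition stationary_equation ::
    "real \<Rightarrow> (real \<Rightarrow> real \<times> real) \<Rightarrow> (real \<Rightarrow> real \<times> real) \<Rightarrow> real set \<Rightarrow> bool" where
  "stationary_equation \<alpha> N \<gamma> I \<longleftrightarrow>
     (\<forall>s\<in>I. arclength_curvature N \<gamma> s = - \<alpha> * (lor (N s) (\<gamma> s) / \<bar>lor (\<gamma> s) (\<gamma> s)\<bar>))"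

text \<open>
  The curvature is defined on arc-length parametrizations, so for a curve with an arbitrary
  parameter the equation is imposed on an arc-length reparametrization; neither the choice of
  the latter nor that of the unit normal field matters.
\<close>

definition stationary_curve :: "real \<Rightarrow> (real \<Rightarrow> real \<times> real) \<Rightarrow> real set \<Rightarrow> bool" where
  "stationary_curve \<alpha> \<gamma> I \<longleftrightarrow>
     (spacelike_curve \<gamma> I \<or> timelike_curve \<gamma> I) \<and> \<gamma> ` I \<inter> light_cone = {} \<and>
     (\<exists>J h N. change_of_parameter h J I \<and> arclength_parametrized (\<gamma> \<circ> h) J \<and>
        unit_normal_field N (\<gamma> \<circ> h) J \<and> stationary_equation \<alpha> N (\<gamma> \<circ> h) J)"

text \<open>
  A line through the origin has \<open>\<kappa> = 0\<close> and \<open>\<langle>N, \<gamma>\<rangle> = 0\<close>, so its pieces off the origin are stationary for every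
  \<open>\<alpha>\<close>, but they have constant hyperbolic angle and hence no parametrization
  \<open>\<rho>(s)(cosh s, sinh s)\<close>. The classification must exclude them.
\<close>

definition radial_line_contains :: "(real \<Rightarrow> real \<times> real) \<Rightarrow> real set \<Rightarrow> bool" where
  "radial_line_contains \<gamma> I \<longleftrightarrow> (\<exists>v. \<gamma> ` I \<subseteq> span {v})"

section \<open>The model curves\<close>

text \<open>The constant \<open>c\<close> is only used when \<open>\<alpha> = -1\<close>.\<close>

definition model_radius :: "real \<Rightarrow> real \<Rightarrow> real \<Rightarrow> real" where
  "model_radius \<alpha> c s =
     (if \<alpha> = -1 then exp (c * s) else sinh ((\<alpha> + 1) * s) powr (-1 / (\<alpha> + 1)))"

definition model_curve :: "real \<Rightarrow> real \<Rightarrow> real \<Rightarrow> real \<times> real" where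
  "model_curve \<alpha> c s = model_radius \<alpha> c s *\<^sub>R (cosh s, sinh s)"

definition model_domain :: "real \<Rightarrow> real set" where
  "model_domain \<alpha> = (if \<alpha> = -1 then UNIV else {s. (\<alpha> + 1) * s > 0})"

section \<open>Branches and their asymptotic behaviour\<close>

text \<open>An end of an open interval \<open>I\<close> is encoded as the filter of the parameter tending to it.\<close>

definition lower_end :: "real set \<Rightarrow> real filter" where
  "lower_end I = (if bdd_below I then at_right (Inf I) else at_bot)"

definition upper_end :: "real set \<Rightarrow> real filter" where
  "upper_end I = (if bdd_above I then at_left (Sup I) else at_top)"

definition ends :: "real set \<Rightarrow> real filter set" where
  "ends I = {lower_end I, upper_end I}"

definition asymptotic_to_line ::
    "(real \<Rightarrow> real \<times> real) \<Rightarrow> real filter \<Rightarrow> (real \<times> real) set \<Rightarrow> bool" where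
  "asymptotic_to_line \<gamma> E L \<longleftrightarrow>
     filterlim \<gamma> at_infinity E \<and> ((\<lambda>s. infdist (\<gamma> s) L) \<longlongrightarrow> 0) E"

definition asymptotic_to_translated_cone ::
    "(real \<Rightarrow> real \<times> real) \<Rightarrow> real filter \<Rightarrow> bool" where
  "asymptotic_to_translated_cone \<gamma> E \<longleftrightarrow>
     (\<exists>v. \<exists>L\<in>cone_lines. asymptotic_to_line \<gamma> E ((+) v ` L))"

text \<open>\<open>w\<close> is the limit of the Euclidean-normalized velocity.\<close>

definition tangent_direction_tends_to ::
    "(real \<Rightarrow> real \<times> real) \<Rightarrow> real filter \<Rightarrow> real \<times> real \<Rightarrow> bool" where
  "tangent_direction_tends_to \<gamma> E w \<longleftrightarrow> ((\<lambda>s. sgn (velocity \<gamma> s)) \<longlongrightarrow> w) E"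

definition goes_to_point_tangentially_to_cone ::
    "(real \<Rightarrow> real \<times> real) \<Rightarrow> real filter \<Rightarrow> real \<times> real \<Rightarrow> bool" where
  "goes_to_point_tangentially_to_cone \<gamma> E p \<longleftrightarrow>
     p \<in> light_cone \<and> (\<gamma> \<longlongrightarrow> p) E \<and>
     (\<exists>w. tangent_direction_tends_to \<gamma> E w \<and> (\<exists>L\<in>cone_lines. p \<in> L \<and> w \<in> L))"

text \<open>\<open>orthogonal\<close> refers to the Euclidean inner product.\<close>

definition goes_to_point_orthogonally_to_cone ::
    "(real \<Rightarrow> real \<times> real) \<Rightarrow> real filter \<Rightarrow> real \<times> real \<Rightarrow> bool" where
  "goes_to_point_orthogonally_to_cone \<gamma> E p \<longleftrightarrow>
     p \<in> light_cone \<and> (\<gamma> \<longlongrightarrow> p) E \<and>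
     (\<exists>w. tangent_direction_tends_to \<gamma> E w \<and>
        (\<exists>L\<in>cone_lines. p \<in> L \<and> (\<forall>q\<in>L. orthogonal w q)))"

definition goes_to_origin_tangentially_to_x_axis ::
    "(real \<Rightarrow> real \<times> real) \<Rightarrow> real filter \<Rightarrow> bool" where
  "goes_to_origin_tangentially_to_x_axis \<gamma> E \<longleftrightarrow>
     (\<gamma> \<longlongrightarrow> 0) E \<and> (\<exists>w\<in>x_axis. tangent_direction_tends_to \<gamma> E w)"

end

theory Submission
  imports Defs
begin

text \<open>
  A curve in the cone \<open>\<C>\<^sup>+\<close> has, up to sign, the polar form \<open>\<rho> (cosh \<theta>, sinh \<theta>)\<close>. In terms of the slope \<open>w = d(ln \<rho>)/d\<theta>\<close> the curve is spacelike
  iff \<open>w\<^sup>2 > 1\<close>, and the stationary equation, which is of second order and invariant under dilations and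
  isometries, becomes the autonomous equation of first order \<open>dw/d\<theta> = (\<alpha> + 1) (w\<^sup>2 - 1)\<close>. Its
  solutions with \<open>w\<^sup>2 > 1\<close> are \<open>w = - coth ((\<alpha> + 1) (\<theta> - \<phi>))\<close>, or constants when
  \<open>\<alpha> = -1\<close>; one more integration gives the model radius up to a factor. The factor is
  removed by a dilation, the shift \<open>\<phi>\<close> by a boost, and the signs by reflections.

  To use \<open>\<theta>\<close> as a parameter one must know that it has no critical point. Along an arc-length
  parametrization \<open>\<rho>\<^sup>2\<theta>' \<rho>\<^bsup>\<alpha>\<^esup>\<close> is constant (\<open>first_integral\<close>), so either \<open>\<theta>'\<close>
  vanishes identically, and the curve lies on a line through the origin, or it vanishes nowhere. In the second case
  \<open>transversal\<close> integrates the equation for \<open>w\<close>, \<open>polar_form\<close> the one for \<open>\<rho>\<close>, and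
  \<open>stationary_imp_transformed_model_curve\<close> assembles the isometry, the dilation and the change of parameter.

  The converse, \<open>transformed_model_curve_stationary\<close>, is the same computation read backwards. The arc-length
  parameter that the definition asks for has no closed form; it is the inverse of an antiderivative of the speed
  (\<open>change_of_parameter_prescribed_velocity\<close>), and its smoothness is the reason for the
  calculus of smooth curves at the beginning.

  The ends of the model are studied in the null coordinates \<open>x + y = \<rho> exp s\<close> and
  \<open>x - y = \<rho> exp (- s)\<close>. For \<open>\<alpha> \<noteq> -1\<close> the radius is \<open>exp (- s)\<close> times a function with a positive limit
  at the unbounded end of the domain, and the null coordinates of position and velocity are explicit exponentials
  times convergent factors; the comparison of these exponentials decides between orthogonal and tangential contact.
  At the end \<open>s = 0\<close> the behaviour of \<open>\<rho>\<close> is that of a power of \<open>s\<close>.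
\<close>

section \<open>Calculus of smooth curves\<close>

text \<open>Smoothness of a composite or of an inverse function is proved one derivative at a time,
  so it needs the notion of order \<open>n\<close>; on open sets the velocity of a function of order
  \<open>n + 1\<close> is of order \<open>n\<close>, and this is the form used in every induction below.\<close>

definition diff_times :: "nat \<Rightarrow> (real \<Rightarrow> 'a::real_normed_vector) \<Rightarrow> real set \<Rightarrow> bool" where
  "diff_times n f I \<longleftrightarrow> (\<forall>k<n. \<forall>t\<in>I. (velocity ^^ k) f differentiable (at t))"

lemma smooth_curve_on_iff_diff_times: "smooth_curve_on f I \<longleftrightarrow> (\<forall>n. diff_times n f I)"
  unfolding smooth_curve_on_def diff_times_def by (meson lessI)

lemma smooth_imp_diff_times: "smooth_curve_on f I \<Longrightarrow> diff_times n f I"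
  by (simp add: smooth_curve_on_iff_diff_times)

lemma diff_times_0 [simp]: "diff_times 0 f I"
  by (simp add: diff_times_def)

lemma diff_times_SucD: "diff_times (Suc n) f I \<Longrightarrow> diff_times n f I"
  by (simp add: diff_times_def)

lemma diff_times_Suc_velocity:
  "diff_times (Suc n) f I \<longleftrightarrow> (\<forall>t\<in>I. f differentiable (at t)) \<and> diff_times n (velocity f) I"
proof -
  have "(\<forall>k<Suc n. \<forall>t\<in>I. (velocity ^^ k) f differentiable (at t)) \<longleftrightarrow>
    (\<forall>t\<in>I. (velocity ^^ 0) f differentiable (at t)) \<and>
    (\<forall>k<n. \<forall>t\<in>I. (velocity ^^ Suc k) f differentiable (at t))"
    by (metis less_Suc_eq_0_disj)
  then show ?thesis
    by (simp add: diff_times_def funpow_swap1)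
qed

lemma has_velocity:
  "f differentiable (at t) \<Longrightarrow> (f has_vector_derivative velocity f t) (at t)"
  by (simp add: velocity_def vector_derivative_works[symmetric])

lemma velocity_eqI: "(f has_vector_derivative f') (at t) \<Longrightarrow> velocity f t = f'"
  by (simp add: velocity_def vector_derivative_at)

lemma diff_times_cong:
  assumes "open I" "\<And>t. t \<in> I \<Longrightarrow> f t = g t" "diff_times n f I"
  shows "diff_times n g I"
  using assms(2,3)
proof (induction n arbitrary: f g)
  case (Suc n)
  have D: "(g has_vector_derivative velocity f t) (at t)" if "t \<in> I" for t
    using Suc.prems that assms(1)
    by (intro has_vector_derivative_transform_within_open[OF has_velocity, of f t I g])
       (auto simp: diff_times_Suc_velocity)
  have "diff_times n (velocity g) I"
    by (rule Suc.IH[of "velocity f"])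
      (use Suc.prems(2) in \<open>auto simp: diff_times_Suc_velocity velocity_eqI[OF D]\<close>)
  then show ?case
    using D by (auto simp: diff_times_Suc_velocity intro: differentiableI_vector)
qed simp

text \<open>The derivative may be given by any function that equals the velocity on \<open>I\<close> only. This is
  what allows closed formulas for derivatives to be used in the inductions.\<close>

lemma diff_times_SucI:
  assumes "open I" "\<And>t. t \<in> I \<Longrightarrow> (f has_vector_derivative f' t) (at t)" "diff_times n f' I"
  shows "diff_times (Suc n) f I"
  unfolding diff_times_Suc_velocity
proof
  show "\<forall>t\<in>I. f differentiable at t"
    using assms(2) by (auto intro: differentiableI_vector)
  show "diff_times n (velocity f) I"
    by (rule diff_times_cong[OF assms(1) _ assms(3)]) (simp add: velocity_eqI[OF assms(2)])
qed

lemma diff_times_velocityD: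
  assumes "diff_times (Suc n) f I"
  shows "t \<in> I \<Longrightarrow> (f has_vector_derivative velocity f t) (at t)" "diff_times n (velocity f) I"
  using assms by (auto simp: diff_times_Suc_velocity intro: has_velocity)

lemma smooth_has_velocity:
  "smooth_curve_on f I \<Longrightarrow> t \<in> I \<Longrightarrow> (f has_vector_derivative velocity f t) (at t)"
  using smooth_imp_diff_times[of f I "Suc 0"] by (rule diff_times_velocityD)

lemma smooth_velocity: "smooth_curve_on f I \<Longrightarrow> smooth_curve_on (velocity f) I"
  by (meson smooth_curve_on_iff_diff_times diff_times_Suc_velocity)

lemma smooth_subset: "smooth_curve_on f I \<Longrightarrow> J \<subseteq> I \<Longrightarrow> smooth_curve_on f J"
  by (auto simp: smooth_curve_on_def)

lemma smooth_cong:
  assumes "open I" "\<And>t. t \<in> I \<Longrightarrow> f t = g t" "smooth_curve_on f I"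
  shows "smooth_curve_on g I"
  using assms diff_times_cong[OF assms(1,2)] by (auto simp: smooth_curve_on_iff_diff_times)

lemma diff_times_const: "open I \<Longrightarrow> diff_times n (\<lambda>t. c) I"
proof (induction n arbitrary: c)
  case (Suc n)
  then show ?case by (intro diff_times_SucI[of _ _ "\<lambda>_. 0"]) auto
qed simp

lemma diff_times_id: "open I \<Longrightarrow> diff_times n (\<lambda>t. t) I"
  by (cases n) (auto intro!: diff_times_SucI[of _ _ "\<lambda>_. 1"] diff_times_const)

lemma diff_times_add:
  "open I \<Longrightarrow> diff_times n f I \<Longrightarrow> diff_times n g I \<Longrightarrow> diff_times n (\<lambda>t. f t + g t) I"
proof (induction n arbitrary: f g)
  case (Suc n)
  note d = diff_times_velocityD[OF Suc.prems(2)] diff_times_velocityD[OF Suc.prems(3)]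
  show ?case
    by (rule diff_times_SucI[OF \<open>open I\<close> has_vector_derivative_add[OF d(1,3)] Suc.IH[OF \<open>open I\<close> d(2,4)]])
qed simp

text \<open>The product rule expresses the derivative by two products, each with a factor of order one less.\<close>

lemma diff_times_bilinear:
  assumes "bounded_bilinear b" "open I"
  shows "diff_times n f I \<Longrightarrow> diff_times n g I \<Longrightarrow> diff_times n (\<lambda>t. b (f t) (g t)) I"
proof (induction n arbitrary: f g)
  case (Suc n)
  note d = diff_times_velocityD[OF Suc.prems(1)] diff_times_velocityD[OF Suc.prems(2)]
  show ?case
    by (rule diff_times_SucI[OF \<open>open I\<close> bounded_bilinear.has_vector_derivative[OF assms(1) d(1,3)]
          diff_times_add[OF \<open>open I\<close> Suc.IH[OF _ d(4)] Suc.IH[OF d(2)]]])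
       (simp_all add: Suc.prems[THEN diff_times_SucD])
qed simp

lemma diff_times_linear:
  assumes "bounded_linear A" "open I"
  shows "diff_times n f I \<Longrightarrow> diff_times n (\<lambda>t. A (f t)) I"
proof (induction n arbitrary: f)
  case (Suc n)
  note d = diff_times_velocityD[OF Suc.prems(1)]
  show ?case
    by (rule diff_times_SucI[OF \<open>open I\<close> bounded_linear.has_vector_derivative[OF assms(1) d(1)] Suc.IH[OF d(2)]])
qed simp

lemma diff_times_Pair:
  assumes "open I"
  shows "diff_times n f I \<Longrightarrow> diff_times n g I \<Longrightarrow> diff_times n (\<lambda>t. (f t, g t)) I"
proof (induction n arbitrary: f g)
  case (Suc n)
  note d = diff_times_velocityD[OF Suc.prems(1)] diff_times_velocityD[OF Suc.prems(2)]
  show ?case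
    by (rule diff_times_SucI[OF \<open>open I\<close> has_vector_derivative_Pair[OF d(1,3)] Suc.IH[OF d(2,4)]])
qed simp

lemma diff_times_compose:
  assumes "open I" "open K" "h ` K \<subseteq> I"
  shows "diff_times n f I \<Longrightarrow> diff_times n h K \<Longrightarrow> diff_times n (f \<circ> h) K"
proof (induction n arbitrary: f)
  case (Suc n)
  note d = diff_times_velocityD[OF Suc.prems(1)] diff_times_velocityD[OF Suc.prems(2)]
  have D: "((f \<circ> h) has_vector_derivative velocity h t *\<^sub>R (velocity f \<circ> h) t) (at t)" if "t \<in> K" for t
    using vector_diff_chain_at[OF d(3)[OF that] d(1)] that assms(3) by auto
  show ?case
    by (rule diff_times_SucI[OF \<open>open K\<close> D
          diff_times_bilinear[OF bounded_bilinear_scaleR \<open>open K\<close> d(4)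
            Suc.IH[OF d(2) diff_times_SucD[OF Suc.prems(2)]]]])
qed simp

lemma smooth_const: "open I \<Longrightarrow> smooth_curve_on (\<lambda>t. c) I"
  by (simp add: smooth_curve_on_iff_diff_times diff_times_const)

lemma smooth_id: "open I \<Longrightarrow> smooth_curve_on (\<lambda>t. t) I"
  by (simp add: smooth_curve_on_iff_diff_times diff_times_id)

lemma smooth_add:
  "open I \<Longrightarrow> smooth_curve_on f I \<Longrightarrow> smooth_curve_on g I \<Longrightarrow> smooth_curve_on (\<lambda>t. f t + g t) I"
  unfolding smooth_curve_on_iff_diff_times by (blast intro: diff_times_add)

lemma smooth_mult:
  fixes f g :: "real \<Rightarrow> real"
  shows "open I \<Longrightarrow> smooth_curve_on f I \<Longrightarrow> smooth_curve_on g I \<Longrightarrow> smooth_curve_on (\<lambda>t. f t * g t) I"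
  unfolding smooth_curve_on_iff_diff_times
  by (blast intro: diff_times_bilinear[OF bounded_bilinear_mult])

lemma smooth_scaleR:
  "open I \<Longrightarrow> smooth_curve_on f I \<Longrightarrow> smooth_curve_on g I \<Longrightarrow> smooth_curve_on (\<lambda>t. f t *\<^sub>R g t) I"
  unfolding smooth_curve_on_iff_diff_times
  by (blast intro: diff_times_bilinear[OF bounded_bilinear_scaleR])

lemma smooth_linear:
  "bounded_linear A \<Longrightarrow> open I \<Longrightarrow> smooth_curve_on f I \<Longrightarrow> smooth_curve_on (\<lambda>t. A (f t)) I"
  unfolding smooth_curve_on_iff_diff_times by (blast intro: diff_times_linear)

lemma smooth_Pair:
  "open I \<Longrightarrow> smooth_curve_on f I \<Longrightarrow> smooth_curve_on g I \<Longrightarrow> smooth_curve_on (\<lambda>t. (f t, g t)) I"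
  unfolding smooth_curve_on_iff_diff_times by (blast intro: diff_times_Pair)

lemma smooth_compose:
  "open I \<Longrightarrow> open K \<Longrightarrow> h ` K \<subseteq> I \<Longrightarrow> smooth_curve_on f I \<Longrightarrow> smooth_curve_on h K \<Longrightarrow>
    smooth_curve_on (f \<circ> h) K"
  unfolding smooth_curve_on_iff_diff_times by (blast intro: diff_times_compose)

lemma smooth_fst: "open I \<Longrightarrow> smooth_curve_on f I \<Longrightarrow> smooth_curve_on (\<lambda>t. fst (f t)) I"
  by (rule smooth_linear[OF bounded_linear_fst])

lemma smooth_snd: "open I \<Longrightarrow> smooth_curve_on f I \<Longrightarrow> smooth_curve_on (\<lambda>t. snd (f t)) I"
  by (rule smooth_linear[OF bounded_linear_snd])

lemma smooth_exp: "smooth_curve_on (exp :: real \<Rightarrow> real) UNIV"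
  unfolding smooth_curve_on_iff_diff_times
proof
  show "diff_times n (exp :: real \<Rightarrow> real) UNIV" for n
  proof (induction n)
    case (Suc n)
    show ?case
      by (rule diff_times_SucI[OF open_UNIV _ Suc])
         (metis DERIV_exp has_real_derivative_iff_has_vector_derivative)
  qed simp
qed

text \<open>The exponent is arbitrary in the induction because differentiation lowers it by one. Roots,
  reciprocals and the logarithm, the derivative of which is the power with exponent \<open>-1\<close>,
  are special cases or consequences.\<close>

lemma smooth_powr: "smooth_curve_on (\<lambda>x::real. x powr r) {0<..}"
  unfolding smooth_curve_on_iff_diff_times
proof
  show "diff_times n (\<lambda>x::real. x powr r) {0<..}" for n
  proof (induction n arbitrary: r)
    case (Suc n)
    show ?case
      by (rule diff_times_SucI[OF _ _ diff_times_bilinear[OF bounded_bilinear_mult _ diff_times_const Suc],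
            of _ r "r - 1"])
         (auto simp: has_real_derivative_iff_has_vector_derivative[symmetric] has_real_derivative_powr)
  qed simp
qed

lemma smooth_ln: "smooth_curve_on (ln :: real \<Rightarrow> real) {0<..}"
  unfolding smooth_curve_on_iff_diff_times
proof
  show "diff_times n (ln :: real \<Rightarrow> real) {0<..}" for n
  proof (cases n)
    case (Suc m)
    have D: "(ln has_vector_derivative t powr -1) (at t)" if "t \<in> {0<..}" for t :: real
      using that DERIV_ln_divide[of t]
      by (simp add: has_real_derivative_iff_has_vector_derivative powr_minus_divide)
    show ?thesis
      unfolding Suc by (rule diff_times_SucI[OF _ D smooth_imp_diff_times[OF smooth_powr]]) auto
  qed simp
qed

text \<open>The derivative of the inverse is \<open>1 / h' \<circ> k\<close>, so each order of differentiability of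
  \<open>k\<close> gives the next one.\<close>

lemma smooth_inverse_function:
  fixes h k :: "real \<Rightarrow> real"
  assumes "open I" "open K" "smooth_curve_on h I" "\<And>t. t \<in> I \<Longrightarrow> velocity h t > 0"
    and k: "k ` K \<subseteq> I" "continuous_on K k" "\<And>s. s \<in> K \<Longrightarrow> h (k s) = s"
  shows "smooth_curve_on k K"
    and "\<And>s. s \<in> K \<Longrightarrow> velocity k s = 1 / velocity h (k s)"
proof -
  define f where "f = (\<lambda>x. x powr -1) \<circ> velocity h"
  have f: "smooth_curve_on f I"
    unfolding f_def using assms
    by (intro smooth_compose[OF _ _ _ smooth_powr] smooth_velocity) auto
  have D: "(k has_vector_derivative (f \<circ> k) s) (at s)" if s: "s \<in> K" for s
  proof -
    have I: "k s \<in> I" using s k(1) by auto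
    have "DERIV k s :> inverse (velocity h (k s))"
    proof (rule has_field_derivative_inverse_basic[where f=h and t=K])
      show "DERIV h (k s) :> velocity h (k s)"
        using smooth_has_velocity[OF assms(3) I]
        by (simp add: has_real_derivative_iff_has_vector_derivative)
      show "velocity h (k s) \<noteq> 0" using assms(4)[OF I] by simp
      show "continuous (at s) k" using k(2) s \<open>open K\<close> continuous_on_eq_continuous_at by blast
    qed (use s k \<open>open K\<close> in auto)
    then show ?thesis
      using assms(4)[OF I]
      by (simp add: has_real_derivative_iff_has_vector_derivative f_def powr_minus)
  qed
  show "smooth_curve_on k K"
    unfolding smooth_curve_on_iff_diff_times
  proof
    show "diff_times n k K" for n
    proof (induction n)
      case (Suc n)
      show ?case
        by (rule diff_times_SucI[OF \<open>open K\<close> D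
              diff_times_compose[OF assms(1,2) k(1) smooth_imp_diff_times[OF f] Suc]])
    qed simp
  qed
  show "velocity k s = 1 / velocity h (k s)" if s: "s \<in> K" for s
    using velocity_eqI[OF D[OF s]] assms(4)[of "k s"] k(1) s
    by (auto simp: f_def powr_minus_divide)
qed

section \<open>Changes of parameter\<close>

lemma open_interval_convex: "open_interval I \<Longrightarrow> convex I"
  by (simp add: open_interval_def is_interval_convex)

lemma open_interval_nonvanishing_sign:
  fixes f :: "real \<Rightarrow> real"
  assumes "open_interval I" "continuous_on I f" "\<And>t. t \<in> I \<Longrightarrow> f t \<noteq> 0"
  shows "(\<forall>t\<in>I. f t > 0) \<or> (\<forall>t\<in>I. f t < 0)"
proof (rule ccontr)
  assume "\<not> ?thesis"
  then obtain s t where "s \<in> I" "t \<in> I" "f s \<le> 0" "0 \<le> f t"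
    by (meson not_less)
  moreover have "is_interval (f ` I)"
    using assms(1,2) by (simp add: open_interval_def is_interval_connected_1 connected_continuous_image)
  ultimately have "0 \<in> f ` I"
    unfolding is_interval_1 by blast
  with assms(3) show False by auto
qed

text \<open>An open interval is described by its two ends in the extended reals, for which the existence of
  an antiderivative is known.\<close>

lemma open_interval_antiderivative:
  fixes v :: "real \<Rightarrow> real"
  assumes "open_interval I" "continuous_on I v"
  obtains F where "\<And>t. t \<in> I \<Longrightarrow> (F has_vector_derivative v t) (at t)"
proof -
  define a where "a = (INF t\<in>I. ereal t)"
  define b where "b = (SUP t\<in>I. ereal t)"
  have I: "open I" "is_interval I" "I \<noteq> {}"
    using assms(1) by (auto simp: open_interval_def)
  have in_I: "t \<in> I" if "a < ereal t" "ereal t < b" for t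
  proof -
    from that obtain r s where "r \<in> I" "r < t" "s \<in> I" "t < s"
      by (auto simp: a_def b_def INF_less_iff less_SUP_iff)
    then show ?thesis using I(2) unfolding is_interval_1 by (meson less_imp_le)
  qed
  have ab: "a < ereal t" "ereal t < b" if t: "t \<in> I" for t
  proof -
    obtain e where "e > 0" "ball t e \<subseteq> I"
      using I(1) t openE by blast
    then have "t - e/2 \<in> I" "t + e/2 \<in> I"
      by (auto simp: subset_iff dist_real_def)
    then have "a \<le> ereal (t - e/2)" "ereal (t + e/2) \<le> b"
      unfolding a_def b_def by (auto intro: INF_lower SUP_upper)
    with \<open>e > 0\<close> show "a < ereal t" "ereal t < b"
      by (auto elim: le_less_trans less_le_trans intro: less_le_trans[of _ "ereal (t + e/2)"])
  qed
  have "a < b"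
    using I(3) ab less_trans by blast
  moreover have "isCont v t" if "a < ereal t" "ereal t < b" for t
    using in_I[OF that] assms(2) I(1) by (simp add: continuous_on_eq_continuous_at)
  ultimately obtain F where "\<And>t. a < ereal t \<Longrightarrow> ereal t < b \<Longrightarrow> (F has_vector_derivative v t) (at t)"
    using einterval_antiderivative[of a b v] by auto
  then show ?thesis
    using that ab by blast
qed

lemma smooth_continuous_on:
  assumes "smooth_curve_on f I"
  shows "continuous_on I f"
  using smooth_has_velocity[OF assms] has_vector_derivative_continuous
  by (blast intro: continuous_at_imp_continuous_on)

text \<open>The inverse of an antiderivative of \<open>v\<close> travels through \<open>I\<close> with velocity \<open>1 / v\<close>. For
  \<open>v\<close> the speed of a curve this is its parametrization by arc-length.\<close>

lemma change_of_parameter_prescribed_velocity: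
  assumes I: "open_interval I" and v: "smooth_curve_on v I" "\<And>t. t \<in> I \<Longrightarrow> v t > (0::real)"
  obtains J k where "change_of_parameter k J I" "\<And>s. s \<in> J \<Longrightarrow> velocity k s = 1 / v (k s)"
proof -
  obtain F where F: "\<And>t. t \<in> I \<Longrightarrow> (F has_vector_derivative v t) (at t)"
    using open_interval_antiderivative[OF I smooth_continuous_on[OF v(1)]] by blast
  have opI: "open I" and intI: "is_interval I" and neI: "I \<noteq> {}"
    using I by (auto simp: open_interval_def)
  have smF: "smooth_curve_on F I"
    unfolding smooth_curve_on_iff_diff_times
    by (meson diff_times_SucD diff_times_SucI[OF opI F] smooth_imp_diff_times v(1))
  have contF: "continuous_on I F"
    using smF by (rule smooth_continuous_on)
  have less: "F s < F t" if "s \<in> I" "t \<in> I" "s < t" for s t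
  proof (rule DERIV_pos_imp_increasing[OF \<open>s < t\<close>])
    fix x assume "s \<le> x" "x \<le> t"
    then have "x \<in> I" using that intI unfolding is_interval_1 by blast
    then show "\<exists>y. DERIV F x :> y \<and> 0 < y"
      using F v(2) has_real_derivative_iff_has_vector_derivative by blast
  qed
  have inj: "inj_on F I"
    by (rule inj_onI) (metis less less_irrefl linorder_neqE)
  obtain k where k: "homeomorphism I (F ` I) F k"
    using homeomorphism_into_1d[OF _ contF refl inj] intI is_interval_path_connected_1 by blast
  have opJ: "open (F ` I)"
    using invariance_of_domain contF opI inj by blast
  have J: "open_interval (F ` I)"
    using opJ neI intI contF
    by (auto simp: open_interval_def is_interval_connected_1 intro: connected_continuous_image)
  have vel: "velocity F t = v t" if "t \<in> I" for t
    using velocity_eqI[OF F[OF that]] .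
  note inverse = smooth_inverse_function[OF opI opJ smF, of k]
  have kim: "k ` F ` I = I" and kcont: "continuous_on (F ` I) k"
    and Fk: "\<And>s. s \<in> F ` I \<Longrightarrow> F (k s) = s"
    using k by (auto simp: homeomorphism_def)
  have smk: "smooth_curve_on k (F ` I)"
    by (rule inverse(1)) (use kim kcont Fk vel v(2) in auto)
  have velk: "velocity k s = 1 / v (k s)" if s: "s \<in> F ` I" for s
  proof -
    have "velocity k s = 1 / velocity F (k s)"
      by (rule inverse(2)) (use kim kcont Fk vel v(2) s in auto)
    moreover have "k s \<in> I" using kim s by blast
    ultimately show ?thesis by (simp add: vel)
  qed
  show ?thesis
  proof (rule that)
    have "velocity k s \<noteq> 0" if "s \<in> F ` I" for s
      using velk[OF that] v(2)[of "k s"] kim that by fastforce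
    then show "change_of_parameter k (F ` I) I"
      using J smk kim by (simp add: change_of_parameter_def)
  qed (rule velk)
qed

section \<open>The differential equation of a stationary curve in polar form\<close>

lemma zero_derivative_imp_const:
  fixes F :: "real \<Rightarrow> real"
  assumes "open_interval K" "\<And>s. s \<in> K \<Longrightarrow> (F has_real_derivative 0) (at s)"
  obtains c where "\<And>s. s \<in> K \<Longrightarrow> F s = c"
  using has_field_derivative_zero_constant[OF open_interval_convex[OF assms(1)], of F]
  by (meson assms(2) has_field_derivative_at_within)

text \<open>The coordinates of a spacelike curve in \<open>\<C>\<^sup>+\<close> parametrized by arc-length. With
  the unit normal \<open>(y', x')\<close> the stationary equation takes the form stated as \<open>stat\<close>.\<close>

locale stationary_arclength =
  fixes \<alpha> :: real and K :: "real set" and x y x1 y1 x2 y2 :: "real \<Rightarrow> real"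
  assumes K: "open_interval K"
    and x: "s \<in> K \<Longrightarrow> (x has_real_derivative x1 s) (at s)"
    and y: "s \<in> K \<Longrightarrow> (y has_real_derivative y1 s) (at s)"
    and x1: "s \<in> K \<Longrightarrow> (x1 has_real_derivative x2 s) (at s)"
    and y1: "s \<in> K \<Longrightarrow> (y1 has_real_derivative y2 s) (at s)"
    and unit: "s \<in> K \<Longrightarrow> x1 s * x1 s - y1 s * y1 s = 1"
    and pos: "s \<in> K \<Longrightarrow> x s * x s - y s * y s > 0"
    and stat: "s \<in> K \<Longrightarrow> y1 s * x2 s - x1 s * y2 s =
      \<alpha> * (x s * y1 s - y s * x1 s) / (x s * x s - y s * y s)"
begin

text \<open>In the polar form \<open>(x, y) = \<plusminus>\<rho> (cosh \<theta>, sinh \<theta>)\<close> one has \<open>Q = \<rho>\<^sup>2\<close>, \<open>f = \<rho>\<^sup>2\<theta>'\<close> and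
  \<open>g = \<rho>\<rho>'\<close>, so that \<open>g / f\<close> is the logarithmic derivative of \<open>\<rho>\<close> with respect to \<open>\<theta>\<close>. The
  function \<open>\<mu>\<close> is the curvature up to sign. None of these changes when the curve is
  replaced by its image under \<open>p \<mapsto> -p\<close>.\<close>

definition Q where "Q s = x s * x s - y s * y s"
definition f where "f s = x s * y1 s - y s * x1 s"
definition g where "g s = x s * x1 s - y s * y1 s"
definition \<mu> where "\<mu> s = - \<alpha> * f s / Q s"
definition \<theta> where "\<theta> s = ln ((x s + y s) / (x s - y s)) / 2"

lemma Q_pos: "s \<in> K \<Longrightarrow> Q s > 0"
  using pos by (simp add: Q_def)

text \<open>The Lorentzian Lagrange identity for the position and the unit velocity.\<close>

lemma g_f: "s \<in> K \<Longrightarrow> (g s)\<^sup>2 - (f s)\<^sup>2 = Q s"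
proof -
  assume s: "s \<in> K"
  have "(g s)\<^sup>2 - (f s)\<^sup>2 = Q s * (x1 s * x1 s - y1 s * y1 s)"
    by (simp add: g_def f_def Q_def power2_eq_square algebra_simps)
  then show ?thesis using unit[OF s] by simp
qed

text \<open>The velocity has constant length, so the acceleration is orthogonal to it and hence a multiple of
  the normal \<open>(y', x')\<close>; the stationary equation gives the factor.\<close>

lemma acceleration:
  assumes s: "s \<in> K"
  shows "x2 s = \<mu> s * y1 s" "y2 s = \<mu> s * x1 s"
proof -
  have "((\<lambda>s. x1 s * x1 s - y1 s * y1 s) has_real_derivative
      (x1 s * x2 s + x2 s * x1 s) - (y1 s * y2 s + y2 s * y1 s)) (at s)"
    using x1[OF s] y1[OF s] by (auto intro!: derivative_eq_intros)
  moreover have "((\<lambda>s. x1 s * x1 s - y1 s * y1 s) has_real_derivative 0) (at s)"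
    using DERIV_const has_field_derivative_transform_within_open[of "\<lambda>_. 1" 0 s K] K s
    by (simp add: unit open_interval_def)
  ultimately have "x1 s * x2 s + x2 s * x1 s - (y1 s * y2 s + y2 s * y1 s) = 0"
    using DERIV_unique by blast
  then have orth: "x1 s * x2 s = y1 s * y2 s" by simp
  have m: "y1 s * x2 s - x1 s * y2 s = - \<mu> s"
    using stat[OF s] by (simp add: \<mu>_def f_def Q_def)
  have "x2 s = x2 s * (x1 s * x1 s - y1 s * y1 s)" using unit[OF s] by simp
  also have "\<dots> = x1 s * (x1 s * x2 s) - y1 s * y1 s * x2 s" by (simp add: algebra_simps)
  also have "\<dots> = - y1 s * (y1 s * x2 s - x1 s * y2 s)" unfolding orth by (simp add: algebra_simps)
  finally show "x2 s = \<mu> s * y1 s" unfolding m by simp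
  have "y2 s = y2 s * (x1 s * x1 s - y1 s * y1 s)" using unit[OF s] by simp
  also have "\<dots> = x1 s * x1 s * y2 s - y1 s * (y1 s * y2 s)" by (simp add: algebra_simps)
  also have "\<dots> = - x1 s * (y1 s * x2 s - x1 s * y2 s)" unfolding orth[symmetric] by (simp add: algebra_simps)
  finally show "y2 s = \<mu> s * x1 s" unfolding m by simp
qed

lemma deriv_Q: "s \<in> K \<Longrightarrow> (Q has_real_derivative 2 * g s) (at s)"
  unfolding Q_def[abs_def] g_def
  by (rule derivative_eq_intros x y refl | assumption | simp add: algebra_simps)+

lemma deriv_f: "s \<in> K \<Longrightarrow> (f has_real_derivative \<mu> s * g s) (at s)"
  unfolding f_def[abs_def] g_def
  by (rule derivative_eq_intros x y x1 y1 refl | assumption | simp add: algebra_simps acceleration)+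

lemma deriv_g: "s \<in> K \<Longrightarrow> (g has_real_derivative 1 + \<mu> s * f s) (at s)"
proof -
  assume s: "s \<in> K"
  have "(g has_real_derivative (x1 s * x1 s - y1 s * y1 s) + (x2 s * x s - y2 s * y s)) (at s)"
    unfolding g_def[abs_def] using s
    by (auto intro!: derivative_eq_intros x y x1 y1 simp: algebra_simps)
  also have "x1 s * x1 s - y1 s * y1 s = 1" using unit[OF s] .
  also have "x2 s * x s - y2 s * y s = \<mu> s * f s"
    using acceleration[OF s] by (simp add: f_def algebra_simps)
  finally show ?thesis .
qed

lemma nonzero_null_coordinates:
  assumes "s \<in> K"
  shows "(x s + y s) / (x s - y s) > 0" "x s - y s \<noteq> 0" "x s + y s \<noteq> 0"
proof -
  have "(x s + y s) * (x s - y s) > 0" using pos[OF assms] by (simp add: algebra_simps)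
  then show "(x s + y s) / (x s - y s) > 0" "x s - y s \<noteq> 0" "x s + y s \<noteq> 0"
    by (auto simp: zero_less_mult_iff zero_less_divide_iff)
qed

lemma deriv_\<theta>: "s \<in> K \<Longrightarrow> (\<theta> has_real_derivative f s / Q s) (at s)"
proof -
  assume s: "s \<in> K"
  note n = nonzero_null_coordinates[OF s]
  have Q: "Q s = (x s + y s) * (x s - y s)" by (simp add: Q_def algebra_simps)
  have "(\<theta> has_real_derivative
      (((x1 s + y1 s) * (x s - y s) - (x s + y s) * (x1 s - y1 s)) / ((x s - y s) * (x s - y s)))
        / ((x s + y s) / (x s - y s)) / 2) (at s)"
    unfolding \<theta>_def[abs_def] using n s
    by (auto intro!: derivative_eq_intros x y simp: divide_simps) (auto simp: algebra_simps)
  also have "(((x1 s + y1 s) * (x s - y s) - (x s + y s) * (x1 s - y1 s)) / ((x s - y s) * (x s - y s)))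
        / ((x s + y s) / (x s - y s)) / 2 =
       ((x1 s + y1 s) * (x s - y s) - (x s + y s) * (x1 s - y1 s)) / 2 / ((x s + y s) * (x s - y s))"
    using n by (simp add: divide_simps)
  also have "(x1 s + y1 s) * (x s - y s) - (x s + y s) * (x1 s - y1 s) = 2 * f s"
    by (simp add: f_def algebra_simps)
  finally show ?thesis unfolding Q[symmetric] by simp
qed

text \<open>Since \<open>f' = \<mu> g = - \<alpha> f g / Q\<close> and \<open>Q' = 2 g\<close>, the logarithmic derivative of
  \<open>f\<close> is \<open>- \<alpha> / 2\<close> times that of \<open>Q\<close>. This integral replaces the uniqueness
  theorem for the second order equation: a curve that is radial at one point is radial everywhere.\<close>

lemma first_integral:
  obtains C where "\<And>s. s \<in> K \<Longrightarrow> f s * Q s powr (\<alpha> / 2) = C"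
proof -
  have "((\<lambda>s. f s * Q s powr (\<alpha> / 2)) has_real_derivative 0) (at s)" if s: "s \<in> K" for s
  proof -
    note [derivative_intros] = has_real_derivative_powr[THEN DERIV_chain2]
    have "Q s powr (\<alpha> / 2 - 1) = Q s powr (\<alpha> / 2) / Q s"
      using Q_pos[OF s] by (simp add: powr_diff)
    then show ?thesis
      using Q_pos[OF s]
      by (auto intro!: derivative_eq_intros deriv_f[OF s] deriv_Q[OF s] simp: \<mu>_def field_simps)
  qed
  then show ?thesis
    using zero_derivative_imp_const[OF K] that by blast
qed

lemma radial_or_transversal: "(\<forall>s\<in>K. f s = 0) \<or> (\<forall>s\<in>K. f s \<noteq> 0)"
proof -
  obtain C where C: "\<And>s. s \<in> K \<Longrightarrow> f s * Q s powr (\<alpha> / 2) = C"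
    using first_integral by blast
  have "f s = 0 \<longleftrightarrow> C = 0" if "s \<in> K" for s
    using C[OF that] Q_pos[OF that] by auto
  then show ?thesis by blast
qed

lemma radial:
  assumes "\<forall>s\<in>K. f s = 0"
  obtains c where "\<And>s. s \<in> K \<Longrightarrow> y s = c * x s"
proof -
  have nz: "x s \<noteq> 0" if "s \<in> K" for s
    using pos[OF that] by (auto simp: not_less)
  have "((\<lambda>s. y s / x s) has_real_derivative 0) (at s)" if s: "s \<in> K" for s
    using assms nz[OF s] s
    by (auto intro!: derivative_eq_intros x[OF s] y[OF s] simp: f_def algebra_simps)
  then obtain c where "\<And>s. s \<in> K \<Longrightarrow> y s / x s = c"
    using zero_derivative_imp_const[OF K] by blast
  then have "y s = c * x s" if "s \<in> K" for s
    using nz that by (auto simp: field_simps)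
  then show ?thesis by (rule that)
qed

text \<open>The slope \<open>w = g / f\<close> satisfies \<open>dw/d\<theta> = (\<alpha> + 1) (w\<^sup>2 - 1)\<close> with
  \<open>w\<^sup>2 > 1\<close>. Separation of variables makes \<open>(w + 1) / (w - 1)\<close> a multiple of
  \<open>exp (- 2 (\<alpha> + 1) \<theta>)\<close>; the statement is this relation without denominators.\<close>

lemma transversal:
  assumes f: "\<And>s. s \<in> K \<Longrightarrow> f s \<noteq> 0"
  obtains E where "E > 0" "\<And>s. s \<in> K \<Longrightarrow> (g s + f s) * exp (2 * (\<alpha> + 1) * \<theta> s) = E * (g s - f s)"
proof -
  define F where "F s = exp (2 * (\<alpha> + 1) * \<theta> s) * ((g s + f s) / (g s - f s))" for s
  have p: "(g s + f s) * (g s - f s) > 0" if s: "s \<in> K" for s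
    using g_f[OF s] Q_pos[OF s] by (simp add: power2_eq_square algebra_simps)
  have p2: "(g s + f s) / (g s - f s) > 0" "g s - f s \<noteq> 0" if s: "s \<in> K" for s
    using p[OF s] by (auto simp: zero_less_mult_iff zero_less_divide_iff)
  have "(F has_real_derivative 0) (at s)" if s: "s \<in> K" for s
  proof -
    have Q: "Q s > 0" "Q s = g s * g s - f s * f s" using Q_pos g_f s by (auto simp: power2_eq_square)
    have d1: "((\<lambda>s. exp (2 * (\<alpha> + 1) * \<theta> s)) has_real_derivative
        exp (2 * (\<alpha> + 1) * \<theta> s) * (2 * (\<alpha> + 1) * (f s / Q s))) (at s)"
      by (auto intro!: derivative_eq_intros deriv_\<theta>[OF s])
    note d2 = DERIV_divide[OF DERIV_add[OF deriv_g[OF s] deriv_f[OF s]]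
        DERIV_diff[OF deriv_g[OF s] deriv_f[OF s]] p2(2)[OF s]]
    note d = DERIV_mult[OF d1 d2, folded F_def]
    have "(1 + \<mu> s * f s + \<mu> s * g s) * (g s - f s) - (g s + f s) * (1 + \<mu> s * f s - \<mu> s * g s)
      = 2 * (\<mu> s * (g s * g s - f s * f s) - f s)" by (simp add: algebra_simps)
    also have "\<dots> = - (2 * (\<alpha> + 1)) * f s"
      using Q(1) unfolding Q(2)[symmetric] \<mu>_def by (simp add: field_simps)
    finally have e: "(1 + \<mu> s * f s + \<mu> s * g s) * (g s - f s) - (g s + f s) * (1 + \<mu> s * f s - \<mu> s * g s) = \<dots>" .
    have q: "Q s = (g s + f s) * (g s - f s)" using Q(2) by (simp add: algebra_simps)
    have "g s + f s \<noteq> 0" using p[OF s] by auto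
    then have "- (2 * (\<alpha> + 1)) * f s / ((g s - f s) * (g s - f s)) =
        - (2 * (\<alpha> + 1) * (f s / Q s) * ((g s + f s) / (g s - f s)))"
      unfolding q using p2(2)[OF s] by (simp add: divide_simps) (simp add: algebra_simps)
    then show ?thesis using d unfolding e by simp
  qed
  then obtain E where E: "\<And>s. s \<in> K \<Longrightarrow> F s = E"
    using zero_derivative_imp_const[OF K] by blast
  obtain s0 where "s0 \<in> K" using K by (auto simp: open_interval_def)
  then have "E > 0" using E[of s0] p2(1)[of s0] unfolding F_def by (metis exp_gt_zero mult_pos_pos)
  moreover have "(g s + f s) * exp (2 * (\<alpha> + 1) * \<theta> s) = E * (g s - f s)" if s: "s \<in> K" for s
    using E[OF s] p2(2)[OF s] unfolding F_def by (simp add: field_simps)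
  ultimately show ?thesis by (rule that)
qed

text \<open>For \<open>\<alpha> \<noteq> -1\<close> the slope is \<open>- coth z\<close> with \<open>z = (\<alpha> + 1) (\<theta> - \<phi>)\<close>, which
  cannot vanish; integrating it once more gives the radius. A reflection, encoded in
  \<open>\<tau>\<close>, makes \<open>z\<close> positive. For \<open>\<alpha> = -1\<close> the slope is the constant \<open>c\<close>.\<close>

theorem polar_form:
  assumes f: "\<And>s. s \<in> K \<Longrightarrow> f s \<noteq> 0"
  obtains c \<phi> \<tau> C where "\<alpha> = -1 \<longrightarrow> c\<^sup>2 > 1" "\<tau> = 1 \<or> \<tau> = -1" "C > 0"
    "\<forall>s\<in>K. \<tau> * (\<theta> s - \<phi>) \<in> model_domain \<alpha>"
    "\<forall>s\<in>K. sqrt (Q s) = C * model_radius \<alpha> c (\<tau> * (\<theta> s - \<phi>))"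
proof -
  obtain E where E: "E > 0"
    "\<And>s. s \<in> K \<Longrightarrow> (g s + f s) * exp (2 * (\<alpha> + 1) * \<theta> s) = E * (g s - f s)"
    using transversal[OF f] by blast
  obtain s0 where s0: "s0 \<in> K" using K by (auto simp: open_interval_def)
  have sqrtQ: "sqrt (Q s) = exp (ln (Q s) / 2)" if "s \<in> K" for s
    using Q_pos[OF that] by (simp add: powr_half_sqrt[symmetric] powr_def)
  show ?thesis
  proof (cases "\<alpha> = -1")
    case True
    have E1: "E \<noteq> 1"
      using E(2)[OF s0] f[OF s0] True by auto
    \<comment> \<open>The solution \<open>w\<close> of \<open>(w + 1) / (w - 1) = E\<close>.\<close>
    define c where "c = (E + 1) / (E - 1)"
    have g: "g s = c * f s" if s: "s \<in> K" for s
      using E(2)[OF s] E1 unfolding c_def True by (simp add: field_simps)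
    have "(c\<^sup>2 - 1) * (f s0)\<^sup>2 = Q s0"
      using g_f[OF s0] unfolding g[OF s0] by (simp add: power_mult_distrib algebra_simps)
    then have c: "c\<^sup>2 > 1"
      using Q_pos[OF s0] by (smt (verit) zero_le_power2 mult_nonpos_nonneg)
    have "((\<lambda>s. ln (Q s) / 2 - c * \<theta> s) has_real_derivative 0) (at s)" if s: "s \<in> K" for s
      using Q_pos[OF s]
      by (auto intro!: derivative_eq_intros deriv_Q[OF s] deriv_\<theta>[OF s] simp: g[OF s])
    then obtain d where d: "\<And>s. s \<in> K \<Longrightarrow> ln (Q s) / 2 - c * \<theta> s = d"
      using zero_derivative_imp_const[OF K, of "\<lambda>s. ln (Q s) / 2 - c * \<theta> s"] by blast
    show ?thesis
    proof (rule that[of c 1 "exp d" 0]; (intro ballI)?)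
      fix s assume s: "s \<in> K"
      show "sqrt (Q s) = exp d * model_radius \<alpha> c (1 * (\<theta> s - 0))"
        using d[OF s] unfolding sqrtQ[OF s] by (simp add: model_radius_def True flip: exp_add)
    qed (use c True in \<open>auto simp: model_domain_def\<close>)
  next
    case False
    define a where "a = \<alpha> + 1"
    have a: "a \<noteq> 0" using False by (simp add: a_def)
    \<comment> \<open>The shift of the angle that turns the constant of integration \<open>E\<close> into \<open>1\<close>.\<close>
    define \<phi> where "\<phi> = ln E / (2 * a)"
    define z where "z s = a * (\<theta> s - \<phi>)" for s
    have exp_z: "exp (2 * a * \<theta> s) = E * (exp (z s) * exp (z s))" for s
    proof -
      have "2 * a * \<theta> s = ln E + z s + z s" using a by (simp add: z_def \<phi>_def field_simps)
      then have "exp (2 * a * \<theta> s) = exp (ln E + z s + z s)" by (rule arg_cong)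
      then show ?thesis using E(1) unfolding exp_add by simp
    qed
    have gz: "g s * sinh (z s) = - f s * cosh (z s)" if s: "s \<in> K" for s
    proof -
      have "E * ((g s + f s) * (exp (z s) * exp (z s))) = E * (g s - f s)"
        using E(2)[OF s] exp_z[of s] unfolding a_def by (simp add: algebra_simps)
      then have "(g s + f s) * (exp (z s) * exp (z s)) = g s - f s" using E(1) by simp
      then show ?thesis
        by (simp add: sinh_def cosh_def exp_minus field_simps)
    qed
    have zn: "z s \<noteq> 0" if s: "s \<in> K" for s
      using gz[OF s] f[OF s] by auto
    have dz: "(z has_real_derivative a * (f s / Q s)) (at s)" if s: "s \<in> K" for s
      unfolding z_def[abs_def] by (auto intro!: derivative_eq_intros deriv_\<theta>[OF s])
    have "continuous_on K z"
      by (meson DERIV_isCont continuous_at_imp_continuous_on dz)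
    then have "(\<forall>s\<in>K. z s > 0) \<or> (\<forall>s\<in>K. z s < 0)"
      by (rule open_interval_nonvanishing_sign[OF K]) (rule zn)
    then obtain \<tau> :: real where \<tau>: "\<tau> = 1 \<or> \<tau> = -1" "\<And>s. s \<in> K \<Longrightarrow> \<tau> * z s > 0"
      by (metis mult_1 mult_minus1 neg_0_less_iff_less)
    have pos: "sinh (\<tau> * z s) > 0" if "s \<in> K" for s using \<tau>(2)[OF that] by simp
    have "((\<lambda>s. ln (Q s) / 2 + ln (sinh (\<tau> * z s)) / a) has_real_derivative 0) (at s)" if s: "s \<in> K" for s
    proof -
      have "((\<lambda>s. ln (Q s) / 2 + ln (sinh (\<tau> * z s)) / a) has_real_derivative
        (g s + \<tau> * (cosh (\<tau> * z s) / sinh (\<tau> * z s)) * f s) / Q s) (at s)"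
        using Q_pos[OF s] pos[OF s] a
        by (auto intro!: derivative_eq_intros deriv_Q[OF s] dz[OF s] simp: field_simps)
      moreover have t: "\<tau> * (cosh (\<tau> * z s) / sinh (\<tau> * z s)) = cosh (z s) / sinh (z s)"
        using \<tau>(1) by auto
      have "cosh (z s) / sinh (z s) * f s = - g s"
        using gz[OF s] zn[OF s] by (simp add: field_simps)
      then have "g s + \<tau> * (cosh (\<tau> * z s) / sinh (\<tau> * z s)) * f s = 0"
        unfolding t by simp
      ultimately show ?thesis by simp
    qed
    then obtain d where d: "\<And>s. s \<in> K \<Longrightarrow> ln (Q s) / 2 + ln (sinh (\<tau> * z s)) / a = d"
      using zero_derivative_imp_const[OF K, of "\<lambda>s. ln (Q s) / 2 + ln (sinh (\<tau> * z s)) / a"] by blast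
    show ?thesis
    proof (rule that[of 0 \<tau> "exp d" \<phi>]; (intro ballI)?)
      fix s assume s: "s \<in> K"
      have z: "(\<alpha> + 1) * (\<tau> * (\<theta> s - \<phi>)) = \<tau> * z s" by (simp add: z_def a_def)
      show "\<tau> * (\<theta> s - \<phi>) \<in> model_domain \<alpha>"
        using \<tau>(2)[OF s] False unfolding model_domain_def by (simp add: z)
      have "ln (Q s) / 2 = d + -1 / a * ln (sinh (\<tau> * z s))"
        using d[OF s] by (simp add: field_simps)
      then have "sqrt (Q s) = exp d * sinh (\<tau> * z s) powr (-1 / a)"
        using pos[OF s] unfolding sqrtQ[OF s]
        by (simp only: exp_add powr_def) auto
      then show "sqrt (Q s) = exp d * model_radius \<alpha> 0 (\<tau> * (\<theta> s - \<phi>))"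
        unfolding model_radius_def z using False by (simp add: a_def)
    qed (use \<tau> False in auto)
  qed
qed

end

section \<open>The model curves are stationary\<close>

lemma smooth_sinh_cosh:
  "smooth_curve_on (sinh :: real \<Rightarrow> real) UNIV" "smooth_curve_on (cosh :: real \<Rightarrow> real) UNIV"
proof -
  have "diff_times n (sinh :: real \<Rightarrow> real) UNIV \<and> diff_times n (cosh :: real \<Rightarrow> real) UNIV" for n
  proof (induction n)
    case (Suc n)
    have "(sinh has_vector_derivative cosh t) (at t)" "(cosh has_vector_derivative sinh t) (at t)" for t :: real
      unfolding has_real_derivative_iff_has_vector_derivative[symmetric]
      by (auto intro!: derivative_eq_intros)
    then show ?case
      using Suc by (auto intro!: diff_times_SucI)
  qed simp
  then show "smooth_curve_on (sinh :: real \<Rightarrow> real) UNIV" "smooth_curve_on (cosh :: real \<Rightarrow> real) UNIV"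
    by (auto simp: smooth_curve_on_iff_diff_times)
qed

lemma lor_simps:
  "lor (a *\<^sub>R p) q = a * lor p q" "lor p (a *\<^sub>R q) = a * lor p q"
  "lor (p + p') q = lor p q + lor p' q" "lor p (q + q') = lor p q + lor p q'"
  "lor 0 q = 0" "lor p 0 = 0"
  by (auto simp: lor_def algebra_simps)

text \<open>The logarithmic derivative of the radius.\<close>

definition model_slope :: "real \<Rightarrow> real \<Rightarrow> real \<Rightarrow> real" where
  "model_slope \<alpha> c s = (if \<alpha> = -1 then c else - cosh ((\<alpha> + 1) * s) / sinh ((\<alpha> + 1) * s))"

lemma open_model_domain: "open (model_domain \<alpha>)"
  by (auto simp: model_domain_def intro!: open_Collect_less continuous_intros)

lemma model_radius_pos: "s \<in> model_domain \<alpha> \<Longrightarrow> model_radius \<alpha> c s > 0"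
  by (auto simp: model_domain_def model_radius_def split: if_splits)

lemma model_slope_square:
  assumes "s \<in> model_domain \<alpha>" "\<alpha> = -1 \<Longrightarrow> c\<^sup>2 > 1"
  shows "(model_slope \<alpha> c s)\<^sup>2 > 1"
proof (cases "\<alpha> = -1")
  case False
  then have "sinh ((\<alpha> + 1) * s) > 0" using assms(1) by (simp add: model_domain_def)
  then have "(sinh ((\<alpha> + 1) * s))\<^sup>2 > 0" by (rule zero_less_power)
  then show ?thesis
    using False unfolding model_slope_def by (simp add: power_divide cosh_square_eq add_divide_distrib)
qed (use assms in \<open>simp add: model_slope_def\<close>)

lemma deriv_model_radius:
  assumes "s \<in> model_domain \<alpha>"
  shows "(model_radius \<alpha> c has_real_derivative model_slope \<alpha> c s * model_radius \<alpha> c s) (at s)"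
proof (cases "\<alpha> = -1")
  case True
  have "model_radius \<alpha> c = (\<lambda>s. exp (c * s))" by (rule ext) (simp add: model_radius_def True)
  then show ?thesis using True by (auto simp: model_slope_def intro!: derivative_eq_intros)
next
  case False
  define a where "a = \<alpha> + 1"
  have a: "a \<noteq> 0" and pos: "sinh (a * s) > 0"
    using assms False by (auto simp: model_domain_def a_def)
  have r: "model_radius \<alpha> c = (\<lambda>s. sinh (a * s) powr (-1 / a))"
    by (rule ext) (simp add: model_radius_def False a_def)
  note [derivative_intros] = has_real_derivative_powr[THEN DERIV_chain2]
  have "sinh (a * s) powr (-1 / a - 1) = sinh (a * s) powr (-1 / a) / sinh (a * s)"
    using pos by (simp add: powr_diff)
  then show ?thesis
    unfolding r using pos a False
    by (auto intro!: derivative_eq_intros simp: model_slope_def a_def[symmetric])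
qed

lemma deriv_model_slope:
  assumes "s \<in> model_domain \<alpha>"
  shows "(model_slope \<alpha> c has_real_derivative (\<alpha> + 1) * ((model_slope \<alpha> c s)\<^sup>2 - 1)) (at s)"
proof (cases "\<alpha> = -1")
  case True
  have "model_slope \<alpha> c = (\<lambda>s. c)" by (rule ext) (simp add: model_slope_def True)
  then show ?thesis using True by simp
next
  case False
  define a where "a = \<alpha> + 1"
  have a: "a \<noteq> 0" and pos: "sinh (a * s) > 0"
    using assms False by (auto simp: model_domain_def a_def)
  have r: "model_slope \<alpha> c = (\<lambda>s. - cosh (a * s) / sinh (a * s))"
    by (rule ext) (simp add: model_slope_def False a_def)
  define S C where "S = sinh (a * s)" and "C = cosh (a * s)"
  have "((\<lambda>s. - cosh (a * s) / sinh (a * s)) has_real_derivative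
      ((- (S * a)) * S - (- C) * (C * a)) / (S * S)) (at s)"
    unfolding S_def C_def using pos by (intro DERIV_divide) (auto intro!: derivative_eq_intros)
  moreover have "((- (S * a)) * S - (- C) * (C * a)) / (S * S) = a * ((- C / S)\<^sup>2 - 1)"
    using pos unfolding S_def[symmetric] by (simp add: field_simps power2_eq_square)
  ultimately show ?thesis
    unfolding r a_def[symmetric] by (simp add: S_def C_def)
qed

lemma smooth_model_curve: "smooth_curve_on (model_curve \<alpha> c) (model_domain \<alpha>)"
proof -
  have dom: "open (model_domain \<alpha>)" by (rule open_model_domain)
  have lin: "smooth_curve_on (\<lambda>s. b * s) (model_domain \<alpha>)" for b :: real
    using dom by (intro smooth_mult smooth_const smooth_id)
  have "smooth_curve_on (model_radius \<alpha> c) (model_domain \<alpha>)"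
  proof (cases "\<alpha> = -1")
    case True
    have "model_radius \<alpha> c = exp \<circ> (\<lambda>s. c * s)" by (rule ext) (simp add: model_radius_def True)
    then show ?thesis using smooth_compose[OF open_UNIV dom _ smooth_exp lin] by simp
  next
    case False
    have "model_radius \<alpha> c = (\<lambda>x. x powr (-1 / (\<alpha> + 1))) \<circ> (sinh \<circ> (\<lambda>s. (\<alpha> + 1) * s))"
      by (rule ext) (simp add: model_radius_def False)
    moreover have "(sinh \<circ> (\<lambda>s. (\<alpha> + 1) * s)) ` model_domain \<alpha> \<subseteq> {0<..}"
      using False by (auto simp: model_domain_def)
    ultimately show ?thesis
      using smooth_compose[OF _ dom _ smooth_powr smooth_compose[OF open_UNIV dom _ smooth_sinh_cosh(1) lin]]
      by auto
  qed
  then have "smooth_curve_on (\<lambda>s. model_radius \<alpha> c s *\<^sub>R (cosh s, sinh s)) (model_domain \<alpha>)"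
    using smooth_sinh_cosh dom by (intro smooth_scaleR smooth_Pair) (auto elim: smooth_subset)
  then show ?thesis
    by (simp add: model_curve_def[abs_def])
qed

lemma velocity_model_curve:
  assumes s: "s \<in> model_domain \<alpha>"
  shows "velocity (model_curve \<alpha> c) s = model_radius \<alpha> c s *\<^sub>R
    (model_slope \<alpha> c s * cosh s + sinh s, model_slope \<alpha> c s * sinh s + cosh s)"
proof (rule velocity_eqI)
  have "((\<lambda>s. (cosh s, sinh s)) has_vector_derivative (sinh s, cosh s)) (at s)"
    by (intro has_vector_derivative_Pair)
       (auto simp flip: has_real_derivative_iff_has_vector_derivative intro!: derivative_eq_intros)
  from has_vector_derivative_scaleR[OF deriv_model_radius[OF s, of c] this]
  show "(model_curve \<alpha> c has_vector_derivative model_radius \<alpha> c s *\<^sub>R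
    (model_slope \<alpha> c s * cosh s + sinh s, model_slope \<alpha> c s * sinh s + cosh s)) (at s)"
    by (simp add: model_curve_def[abs_def] algebra_simps)
qed

lemma velocity_velocity_model_curve:
  fixes \<alpha> c s :: real
  defines "w \<equiv> model_slope \<alpha> c s" and "e \<equiv> (\<alpha> + 1) * ((model_slope \<alpha> c s)\<^sup>2 - 1)"
  assumes s: "s \<in> model_domain \<alpha>"
  shows "velocity (velocity (model_curve \<alpha> c)) s = model_radius \<alpha> c s *\<^sub>R
    ((e + w\<^sup>2 + 1) * cosh s + 2 * w * sinh s, (e + w\<^sup>2 + 1) * sinh s + 2 * w * cosh s)"
proof (rule velocity_eqI)
  let ?w = "model_slope \<alpha> c" and ?\<rho> = "model_radius \<alpha> c"
  let ?u = "\<lambda>s. (?w s * cosh s + sinh s, ?w s * sinh s + cosh s)"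
  have w: "(?w has_real_derivative e) (at s)" unfolding e_def by (rule deriv_model_slope[OF s])
  have "(?u has_vector_derivative
      (e * cosh s + w * sinh s + cosh s, e * sinh s + w * cosh s + sinh s)) (at s)"
    by (intro has_vector_derivative_Pair)
       (auto simp: w_def simp flip: has_real_derivative_iff_has_vector_derivative intro!: derivative_eq_intros w)
  from has_vector_derivative_scaleR[OF deriv_model_radius[OF s, of c] this]
  have "((\<lambda>s. ?\<rho> s *\<^sub>R ?u s) has_vector_derivative ?\<rho> s *\<^sub>R
    ((e + w\<^sup>2 + 1) * cosh s + 2 * w * sinh s, (e + w\<^sup>2 + 1) * sinh s + 2 * w * cosh s)) (at s)"
    by (rule back_subst[of "\<lambda>v. (_ has_vector_derivative v) _"])
       (simp add: w_def power2_eq_square algebra_simps)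
  then show "(velocity (model_curve \<alpha> c) has_vector_derivative ?\<rho> s *\<^sub>R
    ((e + w\<^sup>2 + 1) * cosh s + 2 * w * sinh s, (e + w\<^sup>2 + 1) * sinh s + 2 * w * cosh s)) (at s)"
    by (rule has_vector_derivative_transform_within_open[OF _ open_model_domain s])
       (simp add: velocity_model_curve)
qed

text \<open>The vector \<open>prod.swap V\<close> is normal to \<open>V\<close> and has the opposite square. In the last equation
  the derivative \<open>w' = (\<alpha> + 1) (w\<^sup>2 - 1)\<close> enters as \<open>w' - (w\<^sup>2 - 1) = \<alpha> (w\<^sup>2 - 1)\<close>, and
  this is the stationary equation: \<open>\<langle>N, M''\<rangle> \<langle>M, M\<rangle> = \<alpha> \<langle>N, M\<rangle> \<langle>M', M'\<rangle>\<close> for \<open>N = prod.swap M'\<close>.\<close>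

lemma lor_model_curve:
  fixes \<alpha> c s :: real
  defines "\<rho> \<equiv> model_radius \<alpha> c s" and "w \<equiv> model_slope \<alpha> c s"
    and "M \<equiv> model_curve \<alpha> c s" and "V \<equiv> velocity (model_curve \<alpha> c) s"
    and "W \<equiv> velocity (velocity (model_curve \<alpha> c)) s"
  assumes s: "s \<in> model_domain \<alpha>"
  shows "lor M M = \<rho>\<^sup>2" "lor V V = \<rho>\<^sup>2 * (w\<^sup>2 - 1)" "lor (prod.swap V) M = \<rho>\<^sup>2"
    "lor (prod.swap V) W = \<rho>\<^sup>2 * (\<alpha> * (w\<^sup>2 - 1))"
proof -
  have M: "M = \<rho> *\<^sub>R (cosh s, sinh s)" by (simp add: M_def \<rho>_def model_curve_def)
  have V: "V = \<rho> *\<^sub>R (w * cosh s + sinh s, w * sinh s + cosh s)"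
    unfolding V_def \<rho>_def w_def by (rule velocity_model_curve[OF s])
  define e where "e = (\<alpha> + 1) * (w\<^sup>2 - 1) + w\<^sup>2 + 1"
  have W: "W = \<rho> *\<^sub>R (e * cosh s + 2 * w * sinh s, e * sinh s + 2 * w * cosh s)"
    unfolding W_def \<rho>_def w_def e_def by (rule velocity_velocity_model_curve[OF s])
  have h: "cosh s * cosh s - sinh s * sinh s = 1"
    using hyperbolic_pythagoras[of s] by (simp add: power2_eq_square)
  have "lor M M = \<rho>\<^sup>2 * (cosh s * cosh s - sinh s * sinh s)"
    unfolding M by (simp add: lor_def power2_eq_square algebra_simps)
  then show "lor M M = \<rho>\<^sup>2" unfolding h by simp
  have "lor V V = \<rho>\<^sup>2 * ((w\<^sup>2 - 1) * (cosh s * cosh s - sinh s * sinh s))"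
    unfolding V by (simp add: lor_def power2_eq_square algebra_simps)
  then show "lor V V = \<rho>\<^sup>2 * (w\<^sup>2 - 1)" unfolding h by simp
  have "lor (prod.swap V) M = \<rho>\<^sup>2 * (cosh s * cosh s - sinh s * sinh s)"
    unfolding M V by (simp add: lor_def power2_eq_square algebra_simps)
  then show "lor (prod.swap V) M = \<rho>\<^sup>2" unfolding h by simp
  have "lor (prod.swap V) W = \<rho>\<^sup>2 * ((e - 2 * w\<^sup>2) * (cosh s * cosh s - sinh s * sinh s))"
    unfolding V W by (simp add: lor_def power2_eq_square algebra_simps)
  moreover have "e - 2 * w\<^sup>2 = \<alpha> * (w\<^sup>2 - 1)" by (simp add: e_def algebra_simps)
  ultimately show "lor (prod.swap V) W = \<rho>\<^sup>2 * (\<alpha> * (w\<^sup>2 - 1))" unfolding h by simp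
qed

text \<open>The hyperbolic angle of a point of the model is the parameter, so every line through the origin
  meets it at most once.\<close>

lemma model_curve_proportional_imp_eq:
  assumes "s \<in> model_domain \<alpha>" "t \<in> model_domain \<alpha>" "a \<noteq> 0" "b \<noteq> 0"
    and eq: "b *\<^sub>R model_curve \<alpha> c s = a *\<^sub>R model_curve \<alpha> c t"
  shows "s = t"
proof -
  define p q where "p = b * model_radius \<alpha> c s" and "q = a * model_radius \<alpha> c t"
  have nz: "p \<noteq> 0" "q \<noteq> 0"
    using assms(3,4) model_radius_pos[OF assms(1), of c] model_radius_pos[OF assms(2), of c]
    by (auto simp: p_def q_def)
  have "p * cosh s = q * cosh t" "p * sinh s = q * sinh t"
    using eq by (auto simp: model_curve_def p_def q_def)
  then have "(p * cosh s) * (q * sinh t) = (q * cosh t) * (p * sinh s)" by simp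
  then have "sinh (s - t) = 0"
    using nz by (simp add: sinh_diff)
  then show ?thesis by simp
qed

text \<open>The Lorentzian product is nondegenerate.\<close>

lemma linear_isometry_eq_0:
  assumes "linear_isometry A" "A z = 0"
  shows "z = 0"
proof -
  have "lor z q = 0" for q
    using assms unfolding linear_isometry_def by (metis lor_simps(5))
  from this[of "(1, 0)"] this[of "(0, 1)"] show ?thesis
    by (simp add: lor_def prod_eq_iff)
qed

text \<open>A linear isometry, a dilation and a change of parameter turn the model into a stationary
  curve. The normal field is carried along from the model, where it is the velocity with its two
  coordinates exchanged.\<close>

theorem transformed_model_curve_stationary:
  assumes c: "\<alpha> = -1 \<Longrightarrow> c\<^sup>2 > 1" and A: "linear_isometry A" and "dilation d"
    and J: "J \<subseteq> model_domain \<alpha>" and h: "change_of_parameter h I J"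
    and \<beta>: "\<And>t. t \<in> I \<Longrightarrow> \<beta> t = d (A (model_curve \<alpha> c (h t)))"
  shows "spacelike_curve \<beta> I" "stationary_curve \<alpha> \<beta> I" "\<beta> ` I \<subseteq> cone_plus"
    "\<not> radial_line_contains \<beta> I"
proof -
  let ?M = "model_curve \<alpha> c" and ?D = "model_domain \<alpha>"
  define V where "V = velocity ?M"
  obtain r where r: "r > 0" "d = (\<lambda>p. r *\<^sub>R p)"
    using \<open>dilation d\<close> by (auto simp: dilation_def)
  define B where "B p = r *\<^sub>R A p" for p
  have linA: "bounded_linear A"
    using A by (simp add: linear_isometry_def linear_conv_bounded_linear)
  have B: "bounded_linear B"
    unfolding B_def[abs_def] by (intro bounded_linear_scaleR_right linA bounded_linear_compose[OF bounded_linear_scaleR_right, unfolded o_def])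
  have lorB: "lor (B p) (B q) = r\<^sup>2 * lor p q" for p q
  proof -
    have "lor (A p) (A q) = lor p q" using A unfolding linear_isometry_def by blast
    then show ?thesis by (simp add: B_def lor_simps power2_eq_square)
  qed
  have \<beta>B: "\<beta> t = B (?M (h t))" if "t \<in> I" for t
    using \<beta>[OF that] by (simp add: B_def r(2))
  have I: "open_interval I" and opI: "open I" and neI: "I \<noteq> {}"
    and smh: "smooth_curve_on h I" and h': "\<And>t. t \<in> I \<Longrightarrow> velocity h t \<noteq> 0" and hJ: "h ` I = J"
    using h by (auto simp: change_of_parameter_def open_interval_def)
  have hD: "h t \<in> ?D" if "t \<in> I" for t
    using that hJ J by auto
  have opD: "open ?D" by (rule open_model_domain)
  have smM: "smooth_curve_on ?M ?D" by (rule smooth_model_curve)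
  have smV: "smooth_curve_on V ?D" unfolding V_def by (intro smooth_velocity smM)
  have vM: "(?M has_vector_derivative V u) (at u)" if "u \<in> ?D" for u
    unfolding V_def by (rule smooth_has_velocity[OF smM that])
  note lor_model = lor_model_curve[of _ \<alpha> c, folded V_def]
  have VV: "lor (V u) (V u) > 0" if "u \<in> ?D" for u
    using that model_slope_square[OF that c] model_radius_pos[OF that, of c]
    by (simp add: lor_model V_def[symmetric])
  have MM: "lor (?M u) (?M u) > 0" if "u \<in> ?D" for u
    using that model_radius_pos[OF that, of c] by (simp add: lor_model V_def[symmetric])
  have sm_comp: "smooth_curve_on (\<lambda>s. B (F (m s))) K"
    if "open K" "smooth_curve_on m K" "m ` K \<subseteq> ?D" "smooth_curve_on F ?D" for F m K
    using smooth_linear[OF B \<open>open K\<close> smooth_compose[OF opD \<open>open K\<close> that(3,4,2)]] by simp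
  have sm\<beta>: "smooth_curve_on \<beta> I"
    by (rule smooth_cong[OF opI _ sm_comp[OF opI smh _ smM]]) (auto simp: \<beta>B hD)
  have v\<beta>: "velocity \<beta> t = velocity h t *\<^sub>R B (V (h t))" if t: "t \<in> I" for t
  proof (rule velocity_eqI)
    have "((\<lambda>t. B ((?M \<circ> h) t)) has_vector_derivative B (velocity h t *\<^sub>R V (h t))) (at t)"
      by (intro bounded_linear.has_vector_derivative[OF B] vector_diff_chain_at
          smooth_has_velocity[OF smh t] vM hD t)
    then have "(\<beta> has_vector_derivative B (velocity h t *\<^sub>R V (h t))) (at t)"
      by (rule has_vector_derivative_transform_within_open[OF _ opI t]) (simp add: \<beta>B)
    then show "(\<beta> has_vector_derivative velocity h t *\<^sub>R B (V (h t))) (at t)"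
      by (simp add: linear_simps(5)[OF B])
  qed
  have pos: "lor (velocity \<beta> t) (velocity \<beta> t) > 0" if t: "t \<in> I" for t
    using VV[OF hD[OF t]] h'[OF t] r(1)
    by (simp add: v\<beta>[OF t] lor_simps lorB flip: power2_eq_square mult.assoc)
  show spacelike: "spacelike_curve \<beta> I"
    unfolding spacelike_curve_def regular_curve_def
    using I sm\<beta> pos by (auto simp: lor_simps) (metis lor_simps(5) less_irrefl)
  show cone: "\<beta> ` I \<subseteq> cone_plus"
    using MM hD r(1) by (auto simp: cone_plus_def \<beta>B lorB)
  show "\<not> radial_line_contains \<beta> I"
  proof
    assume "radial_line_contains \<beta> I"
    then obtain v where "\<beta> ` I \<subseteq> span {v}"
      unfolding radial_line_contains_def by blast
    then have v: "\<exists>a. \<beta> t = a *\<^sub>R v" if "t \<in> I" for t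
      using that unfolding span_singleton by blast
    obtain t where t: "t \<in> I" using neI by auto
    \<comment> \<open>On a line through the origin the parameter of the model would be constant along \<open>I\<close>.\<close>
    have eq: "h s = h t" if s: "s \<in> I" for s
    proof -
      obtain a b where a: "\<beta> s = a *\<^sub>R v" and b: "\<beta> t = b *\<^sub>R v"
        using v s t by meson
      have nz: "\<beta> s \<noteq> 0" "\<beta> t \<noteq> 0"
        using cone s t by (auto simp: cone_plus_def lor_simps)
      have "B (b *\<^sub>R ?M (h s) - a *\<^sub>R ?M (h t)) = b *\<^sub>R \<beta> s - a *\<^sub>R \<beta> t"
        using \<beta>B s t by (simp add: linear_simps[OF B])
      also have "\<dots> = 0" by (simp add: a b)
      finally have "A (b *\<^sub>R ?M (h s) - a *\<^sub>R ?M (h t)) = 0"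
        using r(1) by (simp add: B_def)
      then have "b *\<^sub>R ?M (h s) = a *\<^sub>R ?M (h t)"
        using linear_isometry_eq_0[OF A] by (metis right_minus_eq)
      then show ?thesis
        using model_curve_proportional_imp_eq[OF hD[OF s] hD[OF t]] nz a b by auto
    qed
    have "(h has_vector_derivative 0) (at t)"
      by (rule has_vector_derivative_transform_within_open[OF has_vector_derivative_const opI t eq[symmetric]])
    then show False
      using h'[OF t] velocity_eqI by blast
  qed
  define v where "v t = sqrt (lor (velocity \<beta> t) (velocity \<beta> t))" for t
  have smv: "smooth_curve_on v I"
  proof -
    have s: "smooth_curve_on (velocity \<beta>) I" by (rule smooth_velocity[OF sm\<beta>])
    let ?q = "\<lambda>t. fst (velocity \<beta> t) * fst (velocity \<beta> t) + (-1) * (snd (velocity \<beta> t) * snd (velocity \<beta> t))"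
    have "smooth_curve_on ?q I"
      by (intro smooth_add smooth_mult smooth_fst smooth_snd smooth_const opI s)
    moreover have "?q t > 0" if "t \<in> I" for t using pos[OF that] by (simp add: lor_def)
    ultimately have "smooth_curve_on ((\<lambda>x. x powr (1/2)) \<circ> ?q) I"
      by (intro smooth_compose[OF _ opI _ smooth_powr]) auto
    moreover have "((\<lambda>x. x powr (1/2)) \<circ> ?q) t = v t" if "t \<in> I" for t
      using pos[OF that] by (simp add: v_def powr_half_sqrt lor_def)
    ultimately show ?thesis using smooth_cong[OF opI] by blast
  qed
  have vpos: "v t > 0" if "t \<in> I" for t using pos[OF that] by (simp add: v_def)
  obtain K k where k: "change_of_parameter k K I" and k': "\<And>s. s \<in> K \<Longrightarrow> velocity k s = 1 / v (k s)"
    using change_of_parameter_prescribed_velocity[OF I smv vpos] by blast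
  have opK: "open K" and smk: "smooth_curve_on k K" and kI: "k ` K = I"
    using k by (auto simp: change_of_parameter_def open_interval_def)
  have kI': "k s \<in> I" if "s \<in> K" for s using kI that by auto
  define m where "m = h \<circ> k"
  have smm: "smooth_curve_on m K"
    unfolding m_def using smooth_compose[OF opI opK _ smh smk] kI by auto
  have mD: "m s \<in> ?D" if "s \<in> K" for s using hD kI' that by (simp add: m_def)
  have m': "(m has_vector_derivative velocity m s) (at s)" if "s \<in> K" for s
    using smooth_has_velocity[OF smm that] .
  define \<gamma> where "\<gamma> = \<beta> \<circ> k"
  have \<gamma>: "\<gamma> s = B (?M (m s))" if "s \<in> K" for s
    using \<beta>B[OF kI'[OF that]] by (simp add: \<gamma>_def m_def)
  have v\<gamma>_\<beta>: "velocity \<gamma> s = velocity k s *\<^sub>R velocity \<beta> (k s)" if s: "s \<in> K" for s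
    unfolding \<gamma>_def
    by (intro velocity_eqI vector_diff_chain_at smooth_has_velocity[OF smk s] smooth_has_velocity[OF sm\<beta> kI'[OF s]])
  have unit: "lor (velocity \<gamma> s) (velocity \<gamma> s) = 1" if s: "s \<in> K" for s
  proof -
    have "lor (velocity \<gamma> s) (velocity \<gamma> s) = (v (k s))\<^sup>2 / (v (k s))\<^sup>2"
      using pos[OF kI'[OF s]] by (simp add: v\<gamma>_\<beta>[OF s] lor_simps k'[OF s] v_def power2_eq_square)
    then show ?thesis using vpos[OF kI'[OF s]] by simp
  qed
  have v\<gamma>: "velocity \<gamma> s = velocity m s *\<^sub>R B (V (m s))" if s: "s \<in> K" for s
  proof (rule velocity_eqI)
    have "((\<lambda>s. B ((?M \<circ> m) s)) has_vector_derivative B (velocity m s *\<^sub>R V (m s))) (at s)"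
      by (intro bounded_linear.has_vector_derivative[OF B] vector_diff_chain_at m' vM mD s)
    then have "(\<gamma> has_vector_derivative B (velocity m s *\<^sub>R V (m s))) (at s)"
      by (rule has_vector_derivative_transform_within_open[OF _ opK s]) (simp add: \<gamma>)
    then show "(\<gamma> has_vector_derivative velocity m s *\<^sub>R B (V (m s))) (at s)"
      by (simp add: linear_simps(5)[OF B])
  qed
  have vv\<gamma>: "velocity (velocity \<gamma>) s = (velocity m s)\<^sup>2 *\<^sub>R B (velocity V (m s)) +
      velocity (velocity m) s *\<^sub>R B (V (m s))" if s: "s \<in> K" for s
  proof (rule velocity_eqI)
    have 1: "((\<lambda>s. B ((V \<circ> m) s)) has_vector_derivative B (velocity m s *\<^sub>R velocity V (m s))) (at s)"
      by (intro bounded_linear.has_vector_derivative[OF B] vector_diff_chain_at m'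
          smooth_has_velocity[OF smV] mD s)
    have 2: "(velocity m has_real_derivative velocity (velocity m) s) (at s)"
      using smooth_has_velocity[OF smooth_velocity[OF smm] s]
      by (simp add: has_real_derivative_iff_has_vector_derivative)
    have "((\<lambda>s. velocity m s *\<^sub>R B ((V \<circ> m) s)) has_vector_derivative
      velocity m s *\<^sub>R B (velocity m s *\<^sub>R velocity V (m s)) + velocity (velocity m) s *\<^sub>R B ((V \<circ> m) s)) (at s)"
      by (rule has_vector_derivative_scaleR[OF 2 1])
    then have "(velocity \<gamma> has_vector_derivative
      velocity m s *\<^sub>R B (velocity m s *\<^sub>R velocity V (m s)) + velocity (velocity m) s *\<^sub>R B ((V \<circ> m) s)) (at s)"
      by (rule has_vector_derivative_transform_within_open[OF _ opK s]) (simp add: v\<gamma>)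
    then show "(velocity \<gamma> has_vector_derivative (velocity m s)\<^sup>2 *\<^sub>R B (velocity V (m s)) +
      velocity (velocity m) s *\<^sub>R B (V (m s))) (at s)"
      by (simp add: linear_simps(5)[OF B] power2_eq_square)
  qed
  define N where "N s = velocity m s *\<^sub>R B (prod.swap (V (m s)))" for s
  have smN: "smooth_curve_on N K"
  proof -
    have "smooth_curve_on (\<lambda>u. prod.swap (V u)) ?D"
      unfolding prod.swap_def
      by (intro smooth_Pair smooth_fst smooth_snd opD smV)
    from sm_comp[OF opK smm _ this] show ?thesis
      unfolding N_def[abs_def] using mD opK smm by (intro smooth_scaleR smooth_velocity) auto
  qed
  have swap: "lor (prod.swap p) p = 0" "lor (prod.swap p) (prod.swap p) = - lor p p" for p
    by (auto simp: lor_def)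
  show "stationary_curve \<alpha> \<beta> I"
    unfolding stationary_curve_def
  proof (intro conjI exI)
    show "spacelike_curve \<beta> I \<or> timelike_curve \<beta> I" using spacelike by simp
    show "\<beta> ` I \<inter> light_cone = {}" using cone by (auto simp: cone_plus_def light_cone_def)
    show "change_of_parameter k K I" by (rule k)
    show "arclength_parametrized (\<beta> \<circ> k) K"
      using unit by (simp add: arclength_parametrized_def flip: \<gamma>_def)
    have NN: "lor (N s) (N s) = - 1" if s: "s \<in> K" for s
      using unit[OF s] by (simp add: N_def v\<gamma>[OF s] lor_simps lorB swap)
    show "unit_normal_field N (\<beta> \<circ> k) K"
      using smN NN by (auto simp: unit_normal_field_def v\<gamma> N_def lor_simps lorB swap simp flip: \<gamma>_def)
    show "stationary_equation \<alpha> N (\<beta> \<circ> k) K"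
      unfolding stationary_equation_def \<gamma>_def[symmetric]
    proof
      fix s assume s: "s \<in> K"
      define \<rho> w u where "\<rho> = model_radius \<alpha> c (m s)" and "w = (model_slope \<alpha> c (m s))\<^sup>2 - 1"
        and "u = velocity m s"
      note L = lor_model[OF mD[OF s], folded \<rho>_def w_def]
      have \<rho>: "\<rho> > 0" using model_radius_pos[OF mD[OF s]] by (simp add: \<rho>_def)
      have un: "u * u * (r\<^sup>2 * (\<rho>\<^sup>2 * w)) = 1"
        using unit[OF s] by (simp add: v\<gamma>[OF s] lor_simps lorB L flip: u_def V_def)
      have "lor (N s) (velocity (velocity \<gamma>) s) = u * (u * u * (r\<^sup>2 * (\<rho>\<^sup>2 * w))) * \<alpha>"
        by (simp add: vv\<gamma>[OF s] N_def lor_simps lorB swap L power2_eq_square flip: u_def)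
      then have 1: "lor (N s) (velocity (velocity \<gamma>) s) = u * \<alpha>" unfolding un by simp
      have "lor (N s) (\<gamma> s) / \<bar>lor (\<gamma> s) (\<gamma> s)\<bar> = u"
        using \<rho> r(1) by (simp add: \<gamma>[OF s] N_def lor_simps lorB L abs_mult flip: u_def)
      then show "arclength_curvature N \<gamma> s = - \<alpha> * (lor (N s) (\<gamma> s) / \<bar>lor (\<gamma> s) (\<gamma> s)\<bar>)"
        using 1 by (simp add: arclength_curvature_def)
    qed
  qed
qed

section \<open>Every stationary curve that is not radial is a piece of a model\<close>

text \<open>The factor \<open>\<sigma>\<close> tells the two components of the cone \<open>\<C>\<^sup>+\<close> apart. The null
  coordinates \<open>x + y\<close> and \<open>x - y\<close> are \<open>\<sigma>\<rho>e\<^sup>\<theta>\<close> and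
  \<open>\<sigma>\<rho>\<close> times its reciprocal, which determines \<open>\<theta>\<close>.\<close>

lemma null_coordinate_polar_form:
  fixes x y \<sigma> :: real
  assumes Q: "x * x - y * y > 0" and \<sigma>: "\<sigma> = 1 \<or> \<sigma> = -1" "\<sigma> * x > 0"
  defines "\<rho> \<equiv> sqrt (x * x - y * y)" and "\<theta> \<equiv> ln ((x + y) / (x - y)) / 2"
  shows "x = \<sigma> * \<rho> * cosh \<theta>" "y = \<sigma> * \<rho> * sinh \<theta>"
proof -
  have "\<bar>y\<bar> < \<bar>x\<bar>"
    using Q by (simp add: abs_less_iff abs_square_less_1 flip: power2_eq_square) (metis abs_le_square_iff abs_less_iff not_less)
  then have pq: "\<sigma> * (x + y) > 0" "\<sigma> * (x - y) > 0"
    using \<sigma> by auto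
  have exp: "exp \<theta> = sqrt ((x + y) / (x - y))"
  proof -
    have "(x + y) / (x - y) > 0" using pq \<sigma>(1) by (auto simp: zero_less_divide_iff)
    then show ?thesis by (auto simp: \<theta>_def powr_half_sqrt[symmetric] powr_def)
  qed
  define p q where "p = \<sigma> * (x + y)" and "q = \<sigma> * (x - y)"
  have pos: "p > 0" "q > 0" using pq by (simp_all add: p_def q_def)
  have \<rho>: "\<rho> = sqrt (p * q)"
    using \<sigma>(1) by (auto simp: \<rho>_def p_def q_def algebra_simps)
  have e: "exp \<theta> = sqrt (p / q)"
  proof -
    have "\<sigma> \<noteq> 0" using \<sigma>(1) by auto
    then show ?thesis unfolding exp p_def q_def by simp
  qed
  have "\<rho> * exp \<theta> = sqrt (p * p)"
    unfolding \<rho> e real_sqrt_mult[symmetric] using pos by simp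
  then have 1: "\<rho> * exp \<theta> = \<sigma> * (x + y)"
    using pos by (simp add: p_def[symmetric])
  have "\<rho> / exp \<theta> = sqrt (q * q)"
    unfolding \<rho> e real_sqrt_divide[symmetric] using pos by simp
  then have 2: "\<rho> * exp (- \<theta>) = \<sigma> * (x - y)"
    using pos by (simp add: q_def[symmetric] exp_minus divide_inverse)
  have ss: "\<sigma> * \<sigma> = 1" using \<sigma>(1) by auto
  have "\<sigma> * \<rho> * cosh \<theta> = \<sigma> * (\<rho> * exp \<theta> + \<rho> * exp (- \<theta>)) / 2"
    by (simp add: cosh_def algebra_simps)
  also have "\<dots> = (\<sigma> * \<sigma>) * x" unfolding 1 2 by (simp add: algebra_simps)
  finally show "x = \<sigma> * \<rho> * cosh \<theta>" by (simp add: ss)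
  have "\<sigma> * \<rho> * sinh \<theta> = \<sigma> * (\<rho> * exp \<theta> - \<rho> * exp (- \<theta>)) / 2"
    by (simp add: sinh_def algebra_simps)
  also have "\<dots> = (\<sigma> * \<sigma>) * y" unfolding 1 2 by (simp add: algebra_simps)
  finally show "y = \<sigma> * \<rho> * sinh \<theta>" by (simp add: ss)
qed

text \<open>The linear map that shifts the hyperbolic angle by \<open>\<phi>\<close> after the reflection in the
  \<open>x\<close>-axis (\<open>\<tau> = -1\<close>) and composed with \<open>p \<mapsto> -p\<close> (\<open>\<sigma> = -1\<close>).\<close>

definition boost :: "real \<Rightarrow> real \<Rightarrow> real \<Rightarrow> real \<times> real \<Rightarrow> real \<times> real" where
  "boost \<sigma> \<phi> \<tau> p = \<sigma> *\<^sub>R (cosh \<phi> * fst p + sinh \<phi> * (\<tau> * snd p), sinh \<phi> * fst p + cosh \<phi> * (\<tau> * snd p))"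

lemma linear_isometry_boost:
  assumes "\<sigma> = 1 \<or> \<sigma> = -1" "\<tau> = 1 \<or> \<tau> = -1"
  shows "linear_isometry (boost \<sigma> \<phi> \<tau>)"
  unfolding linear_isometry_def
proof (intro conjI allI)
  show "linear (boost \<sigma> \<phi> \<tau>)"
    by (rule linearI) (auto simp: boost_def algebra_simps)
  fix p q
  have s: "\<sigma> * \<sigma> = 1" "\<tau> * \<tau> = 1" using assms by auto
  have h: "cosh \<phi> * cosh \<phi> = sinh \<phi> * sinh \<phi> + 1"
    using cosh_square_eq[of \<phi>] by (simp add: power2_eq_square)
  have "lor (boost \<sigma> \<phi> \<tau> p) (boost \<sigma> \<phi> \<tau> q) = (\<sigma> * \<sigma>) * ((cosh \<phi> * cosh \<phi> - sinh \<phi> * sinh \<phi>) *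
      (fst p * fst q - (\<tau> * \<tau>) * (snd p * snd q)))"
    by (simp add: boost_def lor_def algebra_simps)
  then show "lor (boost \<sigma> \<phi> \<tau> p) (boost \<sigma> \<phi> \<tau> q) = lor p q"
    unfolding s h by (simp add: lor_def)
qed

text \<open>The polar form is obtained along the arc-length parametrization. The angle is a function of the
  point of the curve, so it can be pulled back to the given parameter, where it is smooth; shifted and
  reflected it is the required change of parameter.\<close>

theorem stationary_imp_transformed_model_curve:
  assumes sp: "spacelike_curve \<beta> I" and st: "stationary_curve \<alpha> \<beta> I" and cone: "\<beta> ` I \<subseteq> cone_plus"
    and nonradial: "\<not> radial_line_contains \<beta> I"
  shows "\<exists>c A d h J. (\<alpha> = -1 \<longrightarrow> c\<^sup>2 > 1) \<and> linear_isometry A \<and> dilation d \<and>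
              J \<subseteq> model_domain \<alpha> \<and> change_of_parameter h I J \<and>
              (\<forall>t\<in>I. \<beta> t = d (A (model_curve \<alpha> c (h t))))"
proof -
  have I: "open_interval I" and opI: "open I" and sm\<beta>: "smooth_curve_on \<beta> I"
    and spacelike: "\<And>t. t \<in> I \<Longrightarrow> lor (velocity \<beta> t) (velocity \<beta> t) > 0"
    using sp by (auto simp: spacelike_curve_def regular_curve_def open_interval_def)
  obtain K k N where k: "change_of_parameter k K I" and arc: "arclength_parametrized (\<beta> \<circ> k) K"
    and N: "unit_normal_field N (\<beta> \<circ> k) K" and eq: "stationary_equation \<alpha> N (\<beta> \<circ> k) K"
    using st by (auto simp: stationary_curve_def)
  have K: "open_interval K" and opK: "open K" and smk: "smooth_curve_on k K" and kI: "k ` K = I"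
    using k by (auto simp: change_of_parameter_def open_interval_def)
  have kI': "k s \<in> I" if "s \<in> K" for s using that kI by auto
  define \<gamma> where "\<gamma> = \<beta> \<circ> k"
  have sm\<gamma>: "smooth_curve_on \<gamma> K"
    unfolding \<gamma>_def using smooth_compose[OF opI opK _ sm\<beta> smk] kI by simp
  define V where "V = velocity \<gamma>"
  define W where "W = velocity V"
  have d\<gamma>: "(\<gamma> has_vector_derivative V s) (at s)" and dV: "(V has_vector_derivative W s) (at s)" if "s \<in> K" for s
    using smooth_has_velocity[OF sm\<gamma> that] smooth_has_velocity[OF smooth_velocity[OF sm\<gamma>] that]
    by (simp_all add: V_def W_def)
  have coord: "((\<lambda>s. fst (F s)) has_real_derivative fst d) (at s)"
    "((\<lambda>s. snd (F s)) has_real_derivative snd d) (at s)"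
    if "(F has_vector_derivative d) (at s)" for F :: "real \<Rightarrow> real \<times> real" and d s
    unfolding has_real_derivative_iff_has_vector_derivative
    by (rule bounded_linear.has_vector_derivative[OF bounded_linear_fst that]
        bounded_linear.has_vector_derivative[OF bounded_linear_snd that])+
  have unit: "lor (V s) (V s) = 1" if s: "s \<in> K" for s
  proof -
    have "V s = velocity k s *\<^sub>R velocity \<beta> (k s)"
      unfolding V_def \<gamma>_def
      by (intro velocity_eqI vector_diff_chain_at smooth_has_velocity[OF smk s] smooth_has_velocity[OF sm\<beta> kI'[OF s]])
    then have "lor (V s) (V s) = (velocity k s)\<^sup>2 * lor (velocity \<beta> (k s)) (velocity \<beta> (k s))"
      by (simp add: lor_simps power2_eq_square)
    then have "lor (V s) (V s) \<ge> 0" using spacelike[OF kI'[OF s]] by simp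
    moreover have "\<bar>lor (V s) (V s)\<bar> = 1"
      using arc s by (simp add: arclength_parametrized_def V_def \<gamma>_def)
    ultimately show ?thesis by simp
  qed
  have Q: "lor (\<beta> t) (\<beta> t) > 0" if "t \<in> I" for t
    using cone that by (auto simp: cone_plus_def)
  \<comment> \<open>The normal is a multiple of the velocity with exchanged coordinates, and the equation is
    homogeneous in it.\<close>
  have swap_eq: "snd (V s) * fst (W s) - fst (V s) * snd (W s) =
      \<alpha> * (fst (\<gamma> s) * snd (V s) - snd (\<gamma> s) * fst (V s)) / lor (\<gamma> s) (\<gamma> s)" if s: "s \<in> K" for s
  proof -
    obtain a b where ab: "N s = (a, b)" by (cases "N s")
    obtain p q where pq: "V s = (p, q)" by (cases "V s")
    have n: "a * p = b * q" "\<bar>a * a - b * b\<bar> = 1"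
      using N s unfolding unit_normal_field_def \<gamma>_def[symmetric] V_def[symmetric]
      by (auto simp: lor_def ab pq dest!: bspec[of _ _ s])
    have u: "p * p - q * q = 1" using unit[OF s] by (simp add: lor_def pq)
    define \<nu> where "\<nu> = b * p - a * q"
    have "\<nu> * q = (b * q) * p - a * (q * q)" by (simp add: \<nu>_def algebra_simps)
    also have "\<dots> = a * (p * p - q * q)" unfolding n(1)[symmetric] by (simp add: algebra_simps)
    finally have a: "a = \<nu> * q" by (simp add: u)
    have "\<nu> * p = b * (p * p) - (a * p) * q" by (simp add: \<nu>_def algebra_simps)
    also have "\<dots> = b * (p * p - q * q)" unfolding n(1) by (simp add: algebra_simps)
    finally have b: "b = \<nu> * p" by (simp add: u)
    have \<nu>: "\<nu> \<noteq> 0" using n(2) a b by auto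
    have "- lor (N s) (W s) = - \<alpha> * (lor (N s) (\<gamma> s) / \<bar>lor (\<gamma> s) (\<gamma> s)\<bar>)"
      using eq s unfolding stationary_equation_def arclength_curvature_def \<gamma>_def[symmetric] V_def[symmetric] W_def[symmetric]
      by blast
    moreover have "lor (\<gamma> s) (\<gamma> s) > 0" using Q[OF kI'[OF s]] by (simp add: \<gamma>_def)
    ultimately have "lor (N s) (W s) = \<alpha> * lor (N s) (\<gamma> s) / lor (\<gamma> s) (\<gamma> s)" by simp
    moreover have "lor (N s) z = \<nu> * (q * fst z - p * snd z)" for z
      by (simp add: lor_def ab a b algebra_simps)
    ultimately have "\<nu> * (q * fst (W s) - p * snd (W s)) =
        \<nu> * (\<alpha> * (q * fst (\<gamma> s) - p * snd (\<gamma> s)) / lor (\<gamma> s) (\<gamma> s))" by simp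
    then have "q * fst (W s) - p * snd (W s) =
        \<alpha> * (q * fst (\<gamma> s) - p * snd (\<gamma> s)) / lor (\<gamma> s) (\<gamma> s)"
      using \<nu> by (simp only: mult_cancel_left) simp
    then show ?thesis by (simp add: pq mult.commute)
  qed
  interpret stationary_arclength \<alpha> K "\<lambda>s. fst (\<gamma> s)" "\<lambda>s. snd (\<gamma> s)" "\<lambda>s. fst (V s)" "\<lambda>s. snd (V s)"
    "\<lambda>s. fst (W s)" "\<lambda>s. snd (W s)"
  proof
    fix s assume s: "s \<in> K"
    show "fst (\<gamma> s) * fst (\<gamma> s) - snd (\<gamma> s) * snd (\<gamma> s) > 0"
      using Q[OF kI'[OF s]] by (simp add: lor_def \<gamma>_def)
    show "fst (V s) * fst (V s) - snd (V s) * snd (V s) = 1" using unit[OF s] by (simp add: lor_def)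
    show "snd (V s) * fst (W s) - fst (V s) * snd (W s) =
      \<alpha> * (fst (\<gamma> s) * snd (V s) - snd (\<gamma> s) * fst (V s)) /
        (fst (\<gamma> s) * fst (\<gamma> s) - snd (\<gamma> s) * snd (\<gamma> s))"
      using swap_eq[OF s] by (simp add: lor_def)
    show "((\<lambda>s. fst (\<gamma> s)) has_real_derivative fst (V s)) (at s)"
      "((\<lambda>s. snd (\<gamma> s)) has_real_derivative snd (V s)) (at s)"
      by (rule coord[OF d\<gamma>[OF s]])+
    show "((\<lambda>s. fst (V s)) has_real_derivative fst (W s)) (at s)"
      "((\<lambda>s. snd (V s)) has_real_derivative snd (W s)) (at s)"
      by (rule coord[OF dV[OF s]])+
  qed (rule K)
  have f0: "f s \<noteq> 0" if s: "s \<in> K" for s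
  proof
    assume "f s = 0"
    then obtain c where c: "\<And>s. s \<in> K \<Longrightarrow> snd (\<gamma> s) = c * fst (\<gamma> s)"
      using radial_or_transversal radial s by metis
    have "\<beta> ` I \<subseteq> span {(1, c)}"
    proof
      fix p assume "p \<in> \<beta> ` I"
      then obtain s where "s \<in> K" "p = \<gamma> s" using kI by (auto simp: \<gamma>_def)
      then have "p = fst p *\<^sub>R (1, c)" using c by (simp add: prod_eq_iff)
      then show "p \<in> span {(1, c)}" unfolding span_singleton by blast
    qed
    with nonradial show False by (auto simp: radial_line_contains_def)
  qed
  obtain c \<phi> \<tau> C where c: "\<alpha> = -1 \<longrightarrow> c\<^sup>2 > 1" and \<tau>: "\<tau> = 1 \<or> \<tau> = -1" and C: "C > 0"
    and dom: "\<forall>s\<in>K. \<tau> * (\<theta> s - \<phi>) \<in> model_domain \<alpha>"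
    and rad: "\<forall>s\<in>K. sqrt (Q s) = C * model_radius \<alpha> c (\<tau> * (\<theta> s - \<phi>))"
    using f0 by (rule polar_form)
  define \<Theta> where "\<Theta> t = ln ((fst (\<beta> t) + snd (\<beta> t)) / (fst (\<beta> t) - snd (\<beta> t))) / 2" for t
  have \<theta>: "\<theta> s = \<Theta> (k s)" for s
    unfolding \<theta>_def \<Theta>_def by (simp add: \<gamma>_def)
  define h where "h t = \<tau> * (\<Theta> t - \<phi>)" for t
  have null: "(fst (\<beta> t) + snd (\<beta> t)) / (fst (\<beta> t) - snd (\<beta> t)) > 0"
    "(fst (\<beta> t) - snd (\<beta> t)) * (fst (\<beta> t) - snd (\<beta> t)) > 0" if t: "t \<in> I" for t
  proof -
    obtain s where "s \<in> K" "t = k s" using kI t by auto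
    then show "(fst (\<beta> t) + snd (\<beta> t)) / (fst (\<beta> t) - snd (\<beta> t)) > 0"
      "(fst (\<beta> t) - snd (\<beta> t)) * (fst (\<beta> t) - snd (\<beta> t)) > 0"
      using nonzero_null_coordinates[of s] by (auto simp: \<gamma>_def zero_less_mult_iff)
  qed
  have smh: "smooth_curve_on h I"
  proof -
    let ?x = "\<lambda>t. fst (\<beta> t)" and ?y = "\<lambda>t. snd (\<beta> t)"
    have d: "smooth_curve_on (\<lambda>t. ?x t + -1 * ?y t) I"
      by (intro smooth_add smooth_mult smooth_fst smooth_snd smooth_const opI sm\<beta>)
    let ?D = "\<lambda>t. (?x t + -1 * ?y t) * (?x t + -1 * ?y t)"
    have "smooth_curve_on ?D I" by (intro smooth_mult opI d)
    then have "smooth_curve_on ((\<lambda>x. x powr -1) \<circ> ?D) I"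
      using null(2) by (intro smooth_compose[OF _ opI _ smooth_powr]) auto
    then have "smooth_curve_on (\<lambda>t. (?x t + ?y t) * (?x t + -1 * ?y t) * ((\<lambda>x. x powr -1) \<circ> ?D) t) I"
      by (intro smooth_mult smooth_add smooth_fst smooth_snd opI sm\<beta> d)
    moreover have e: "(?x t + ?y t) * (?x t + -1 * ?y t) * ((\<lambda>x. x powr -1) \<circ> ?D) t =
        (?x t + ?y t) / (?x t - ?y t)" if "t \<in> I" for t
    proof -
      define p d where "p = ?x t + ?y t" and "d = ?x t - ?y t"
      have "d * d > 0" using null(2)[OF that] by (simp add: d_def)
      then have "p * d * (d * d) powr -1 = p / d"
        by (subst powr_minus_divide) auto
      then show ?thesis by (simp add: p_def d_def)
    qed
    ultimately have "smooth_curve_on (\<lambda>t. (?x t + ?y t) / (?x t - ?y t)) I"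
      by (intro smooth_cong[OF opI e])
    then have "smooth_curve_on (ln \<circ> (\<lambda>t. (?x t + ?y t) / (?x t - ?y t))) I"
      using null(1) by (intro smooth_compose[OF _ opI _ smooth_ln]) auto
    then have "smooth_curve_on (\<lambda>t. \<tau> * ((1/2) * (ln \<circ> (\<lambda>t. (?x t + ?y t) / (?x t - ?y t))) t + - \<phi>)) I"
      by (intro smooth_mult smooth_add smooth_const opI)
    then show ?thesis by (simp add: h_def[abs_def] \<Theta>_def)
  qed
  have h': "velocity h t \<noteq> 0" if t: "t \<in> I" for t
  proof
    assume h0: "velocity h t = 0"
    obtain s where s: "s \<in> K" "t = k s" using kI t by auto
    have "(h \<circ> k has_vector_derivative velocity k s *\<^sub>R velocity h (k s)) (at s)"
      by (intro vector_diff_chain_at smooth_has_velocity[OF smk s(1)] smooth_has_velocity[OF smh kI'[OF s(1)]])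
    then have "(h \<circ> k has_real_derivative 0) (at s)"
      using h0 s(2) by (simp add: has_real_derivative_iff_has_vector_derivative)
    moreover have "(h \<circ> k has_real_derivative \<tau> * (f s / Q s)) (at s)"
      unfolding h_def[abs_def] o_def \<theta>[symmetric]
      by (auto intro!: derivative_eq_intros deriv_\<theta>[OF s(1)])
    ultimately have "\<tau> * (f s / Q s) = 0" using DERIV_unique by blast
    then show False using \<tau> f0[OF s(1)] Q_pos[OF s(1)] by auto
  qed
  have "continuous_on I (\<lambda>t. fst (\<beta> t))"
    by (intro continuous_on_fst smooth_continuous_on sm\<beta>)
  moreover have "fst (\<beta> t) \<noteq> 0" if "t \<in> I" for t
    using Q[OF that] by (auto simp: lor_def not_less)
  ultimately obtain \<sigma> :: real where \<sigma>: "\<sigma> = 1 \<or> \<sigma> = -1" "\<And>t. t \<in> I \<Longrightarrow> \<sigma> * fst (\<beta> t) > 0"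
    using open_interval_nonvanishing_sign[OF I, of "\<lambda>t. fst (\<beta> t)"]
    by (metis mult_1 mult_minus1 neg_0_less_iff_less)
  show ?thesis
  proof (intro exI conjI ballI)
    show "\<alpha> = -1 \<longrightarrow> c\<^sup>2 > 1" by (rule c)
    show "linear_isometry (boost \<sigma> \<phi> \<tau>)" by (rule linear_isometry_boost[OF \<sigma>(1) \<tau>])
    show "dilation (\<lambda>p. C *\<^sub>R p)" using C by (auto simp: dilation_def)
    show "h ` I \<subseteq> model_domain \<alpha>" using dom kI by (auto simp: h_def \<theta>)
    show "change_of_parameter h I (h ` I)" using I smh h' by (simp add: change_of_parameter_def)
    fix t assume t: "t \<in> I"
    obtain s where s: "s \<in> K" "t = k s" using kI t by auto
    let ?x = "fst (\<beta> t)" and ?y = "snd (\<beta> t)"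
    have R: "sqrt (?x * ?x - ?y * ?y) = C * model_radius \<alpha> c (h t)"
      using bspec[OF rad s(1), unfolded Q_def \<theta>] by (simp add: h_def s(2) \<gamma>_def)
    have "?x = \<sigma> * (C * model_radius \<alpha> c (h t)) * cosh (\<Theta> t)"
      "?y = \<sigma> * (C * model_radius \<alpha> c (h t)) * sinh (\<Theta> t)"
      using null_coordinate_polar_form[of ?x ?y \<sigma>] Q[OF t] \<sigma>(1) \<sigma>(2)[OF t]
      unfolding R \<Theta>_def[symmetric] by (auto simp: lor_def)
    moreover have "\<Theta> t = \<phi> + \<tau> * h t" using \<tau> by (auto simp: h_def)
    moreover have "cosh (\<tau> * h t) = cosh (h t)" "sinh (\<tau> * h t) = \<tau> * sinh (h t)"
      using \<tau> by auto
    ultimately show "\<beta> t = C *\<^sub>R boost \<sigma> \<phi> \<tau> (model_curve \<alpha> c (h t))"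
      by (simp add: prod_eq_iff boost_def model_curve_def cosh_add sinh_add algebra_simps)
  qed
qed

section \<open>The ends of the model curves\<close>

lemma not_bdd_real:
  "\<not> bdd_above (UNIV :: real set)" "\<not> bdd_below (UNIV :: real set)"
  "\<not> bdd_above {0::real<..}" "\<not> bdd_below {..<0::real}"
proof -
  show a: "\<not> bdd_above {0::real<..}"
  proof
    assume "bdd_above {0::real<..}"
    then obtain m where "\<And>x. x > 0 \<Longrightarrow> x \<le> (m::real)" by (auto simp: bdd_above_def)
    from this[of "\<bar>m\<bar> + 1"] show False by linarith
  qed
  show b: "\<not> bdd_below {..<0::real}"
  proof
    assume "bdd_below {..<0::real}"
    then obtain m where "\<And>x. x < 0 \<Longrightarrow> (m::real) \<le> x" by (auto simp: bdd_below_def)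
    from this[of "- \<bar>m\<bar> - 1"] show False by linarith
  qed
  show "\<not> bdd_above (UNIV :: real set)"
    using a by (rule contrapos_nn) (rule bdd_above_mono[OF _ subset_UNIV])
  show "\<not> bdd_below (UNIV :: real set)"
    using b by (rule contrapos_nn) (rule bdd_below_mono[OF _ subset_UNIV])
qed

lemma ends_UNIV: "ends UNIV = {at_bot, at_top}"
  by (simp add: ends_def lower_end_def upper_end_def not_bdd_real)

lemma ends_greaterThan: "ends {0::real<..} = {at_right 0, at_top}"
  by (simp add: ends_def lower_end_def upper_end_def not_bdd_real)

lemma ends_lessThan: "ends {..<0::real} = {at_bot, at_left 0}"
  by (simp add: ends_def lower_end_def upper_end_def not_bdd_real)

lemma model_domain_pos: "\<alpha> > -1 \<Longrightarrow> model_domain \<alpha> = {0<..}"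
  by (auto simp: model_domain_def zero_less_mult_iff)

lemma model_domain_neg: "\<alpha> < -1 \<Longrightarrow> model_domain \<alpha> = {..<0}"
  by (auto simp: model_domain_def zero_less_mult_iff)

text \<open>A positive factor, which may tend to zero or to infinity, can be divided out of the velocity.\<close>

lemma tangent_direction_tends_to_sgn:
  assumes ev: "\<forall>\<^sub>F s in E. r s > 0 \<and> velocity \<gamma> s = r s *\<^sub>R W s"
    and W: "(W \<longlongrightarrow> w) E" "w \<noteq> 0"
  shows "tangent_direction_tends_to \<gamma> E (sgn w)"
  unfolding tangent_direction_tends_to_def
proof (rule Lim_transform_eventually[OF tendsto_sgn[OF W]])
  show "\<forall>\<^sub>F s in E. sgn (W s) = sgn (velocity \<gamma> s)"
    using ev by eventually_elim (simp add: sgn_scaleR)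
qed

lemma tendsto_from_null_coordinates:
  fixes F :: "'a \<Rightarrow> real \<times> real"
  assumes "((\<lambda>s. fst (F s) + snd (F s)) \<longlongrightarrow> a) E" "((\<lambda>s. fst (F s) - snd (F s)) \<longlongrightarrow> b) E"
  shows "(F \<longlongrightarrow> ((a + b) / 2, (a - b) / 2)) E"
proof -
  have "((\<lambda>s. (((fst (F s) + snd (F s)) + (fst (F s) - snd (F s))) / 2,
      ((fst (F s) + snd (F s)) - (fst (F s) - snd (F s))) / 2)) \<longlongrightarrow> ((a + b) / 2, (a - b) / 2)) E"
    by (intro tendsto_intros assms) auto
  then show ?thesis by simp
qed

lemma model_curve_null_coordinates:
  "fst (model_curve \<alpha> c s) + snd (model_curve \<alpha> c s) = model_radius \<alpha> c s * exp s"
  "fst (model_curve \<alpha> c s) - snd (model_curve \<alpha> c s) = model_radius \<alpha> c s * exp (- s)"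
  by (simp_all add: model_curve_def cosh_def sinh_def field_simps)

lemma infdist_le_norm:
  fixes p :: "real \<times> real"
  assumes "p' \<in> L"
  shows "infdist p L \<le> norm (p - p')"
  using infdist_le[OF assms, of p] by (simp add: dist_norm)

lemma asymptotic_to_lineI:
  assumes inf: "filterlim \<gamma> at_infinity E" and p: "\<And>s. p s \<in> L" "((\<lambda>s. \<gamma> s - p s) \<longlongrightarrow> 0) E"
  shows "asymptotic_to_line \<gamma> E L"
  unfolding asymptotic_to_line_def
proof
  show "((\<lambda>s. infdist (\<gamma> s) L) \<longlongrightarrow> 0) E"
    by (rule tendsto_sandwich[OF _ _ tendsto_const tendsto_norm_zero[OF p(2)]])
       (auto intro!: always_eventually infdist_le_norm infdist_nonneg p(1))
qed (rule inf)

text \<open>Once the factor \<open>exp z\<close> is split off, what remains of \<open>sinh z\<close> has a positive limit at infinity.\<close>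

lemma sinh_powr_exp:
  assumes "z > (0::real)"
  shows "sinh z powr r = exp (r * z) * ((1 - exp (- 2 * z)) / 2) powr r"
proof -
  have "sinh z = exp z * ((1 - exp (- 2 * z)) / 2)"
    by (simp add: sinh_def algebra_simps flip: exp_add)
  moreover have "exp z powr r = exp (r * z)" by (simp add: powr_def)
  ultimately show ?thesis using assms by (simp only: powr_mult)
qed

lemma tendsto_sinh_factor:
  assumes "filterlim u at_top E"
  shows "((\<lambda>s. ((1 - exp (- 2 * u s)) / 2 :: real) powr r) \<longlongrightarrow> (1/2) powr r) E"
proof -
  have "filterlim (\<lambda>s. 2 * u s) at_top E"
    by (rule filterlim_tendsto_pos_mult_at_top[OF tendsto_const _ assms]) simp
  then have "filterlim (\<lambda>s. - (2 * u s)) at_bot E"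
    unfolding filterlim_uminus_at_bot by simp
  then have "((\<lambda>s. exp (- 2 * u s)) \<longlongrightarrow> 0) E"
    using filterlim_compose[OF exp_at_bot] by simp
  then have "((\<lambda>s. ((1 - exp (- 2 * u s)) / 2) powr r) \<longlongrightarrow> ((1 - 0) / 2) powr r) E"
    by (intro tendsto_intros) auto
  then show ?thesis by simp
qed

lemma coth_minus_1: "z > (0::real) \<Longrightarrow> cosh z / sinh z - 1 = exp (- 2 * z) * (2 / (1 - exp (- 2 * z)))"
proof -
  assume z: "z > 0"
  have sc: "sinh z = exp z * ((1 - exp (- 2 * z)) / 2)" "cosh z = exp z * ((1 + exp (- 2 * z)) / 2)"
    by (simp_all add: sinh_def cosh_def algebra_simps flip: exp_add)
  have q: "cosh z / sinh z = (1 + exp (- 2 * z)) / (1 - exp (- 2 * z))"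
    unfolding sc by simp
  have "1 - exp (- 2 * z) \<noteq> 0" using z by simp
  then show ?thesis unfolding q by (simp add: divide_simps)
qed

lemma model_radius_exp:
  assumes "s > 0" "\<alpha> > -1"
  shows "model_radius \<alpha> c s = exp (- s) * ((1 - exp (- 2 * ((\<alpha> + 1) * s))) / 2) powr (-1 / (\<alpha> + 1))"
  using assms by (simp add: model_radius_def sinh_powr_exp)

lemma tendsto_exp_neg_mult: "b > 0 \<Longrightarrow> ((\<lambda>s. exp (- b * s)) \<longlongrightarrow> 0) (at_top :: real filter)"
proof -
  assume b: "b > 0"
  have "filterlim (\<lambda>s. b * s) at_top (at_top :: real filter)"
    by (rule filterlim_tendsto_pos_mult_at_top[OF tendsto_const b filterlim_ident])
  then have "filterlim (\<lambda>s. - (b * s)) at_bot (at_top :: real filter)"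
    unfolding filterlim_uminus_at_bot by simp
  then show ?thesis using filterlim_compose[OF exp_at_bot] by simp
qed

text \<open>At infinity \<open>\<rho>\<close> decays like a constant times \<open>exp (- s)\<close>, which is exactly the rate at which
  \<open>x + y = \<rho> exp s\<close> has a positive limit, while \<open>x - y = \<rho> exp (- s)\<close> tends to zero.\<close>

lemma model_curve_tendsto_cone_point:
  assumes \<alpha>: "\<alpha> > -1"
  obtains b where "b > 0" "(model_curve \<alpha> c \<longlongrightarrow> (b, b)) at_top"
proof -
  define a where "a = \<alpha> + 1"
  have a: "a > 0" using \<alpha> by (simp add: a_def)
  define k where "k s = ((1 - exp (- 2 * (a * s))) / 2) powr (-1 / a)" for s
  have r: "model_radius \<alpha> c s = exp (- s) * k s" if "s > 0" for s
    using model_radius_exp[OF that \<alpha>] by (simp add: k_def a_def)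
  have k: "(k \<longlongrightarrow> (1/2) powr (-1 / a)) at_top"
    unfolding k_def[abs_def]
    by (intro tendsto_sinh_factor filterlim_tendsto_pos_mult_at_top[OF tendsto_const a] filterlim_ident)
  have "((\<lambda>s. model_radius \<alpha> c s * exp s) \<longlongrightarrow> (1/2) powr (-1 / a)) at_top"
  proof (rule Lim_transform_eventually[OF k])
    show "\<forall>\<^sub>F s in at_top. k s = model_radius \<alpha> c s * exp s"
      using eventually_gt_at_top[of "0::real"] by eventually_elim (simp add: r exp_minus)
  qed
  moreover have "((\<lambda>s. model_radius \<alpha> c s * exp (- s)) \<longlongrightarrow> 0) at_top"
  proof (rule Lim_transform_eventually)
    show "((\<lambda>s. exp (- 2 * s) * k s) \<longlongrightarrow> 0) at_top"
      using tendsto_mult[OF tendsto_exp_neg_mult[of 2] k] by simp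
    show "\<forall>\<^sub>F s in at_top. exp (- 2 * s) * k s = model_radius \<alpha> c s * exp (- s)"
      using eventually_gt_at_top[of "0::real"]
      by eventually_elim (simp add: r mult.assoc mult.left_commute flip: exp_add)
  qed
  ultimately have "(model_curve \<alpha> c \<longlongrightarrow>
      (((1/2) powr (-1 / a) + 0) / 2, ((1/2) powr (-1 / a) - 0) / 2)) at_top"
    by (intro tendsto_from_null_coordinates) (simp_all add: model_curve_null_coordinates)
  then show ?thesis by (intro that[of "(1/2) powr (-1 / a) / 2"]) auto
qed

lemma velocity_null_coordinates:
  assumes "s \<in> model_domain \<alpha>"
  shows "fst (velocity (model_curve \<alpha> c) s) + snd (velocity (model_curve \<alpha> c) s) =
      model_radius \<alpha> c s * exp s * (model_slope \<alpha> c s + 1)"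
    "fst (velocity (model_curve \<alpha> c) s) - snd (velocity (model_curve \<alpha> c) s) =
      model_radius \<alpha> c s * exp (- s) * (model_slope \<alpha> c s - 1)"
  by (simp_all add: velocity_model_curve[OF assms] cosh_def sinh_def field_simps)

lemma tendsto_coth:
  assumes "b > 0"
  shows "((\<lambda>s. cosh (b * s) / sinh (b * s)) \<longlongrightarrow> (1::real)) at_top"
    "((\<lambda>s. 2 / (1 - exp (- 2 * (b * s)))) \<longlongrightarrow> (2::real)) at_top"
proof -
  have e: "((\<lambda>s. exp (- 2 * (b * s))) \<longlongrightarrow> 0) at_top"
    using tendsto_exp_neg_mult[of "2 * b"] assms by (simp add: mult.assoc)
  have "((\<lambda>s. 2 / (1 - exp (- 2 * (b * s)))) \<longlongrightarrow> 2 / (1 - 0)) at_top"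
    by (intro tendsto_intros e) auto
  then show t: "((\<lambda>s. 2 / (1 - exp (- 2 * (b * s)))) \<longlongrightarrow> (2::real)) at_top" by simp
  have lim: "((\<lambda>s. exp (- 2 * (b * s)) * (2 / (1 - exp (- 2 * (b * s)))) + 1) \<longlongrightarrow> 0 * 2 + 1) at_top"
    by (intro tendsto_intros e t)
  have "\<forall>\<^sub>F s in at_top. exp (- 2 * (b * s)) * (2 / (1 - exp (- 2 * (b * s)))) + 1 = cosh (b * s) / sinh (b * s)"
    using eventually_gt_at_top[of "0::real"]
  proof eventually_elim
    case (elim s)
    then show ?case using coth_minus_1[of "b * s"] assms by simp
  qed
  from Lim_transform_eventually[OF lim this]
  show "((\<lambda>s. cosh (b * s) / sinh (b * s)) \<longlongrightarrow> (1::real)) at_top" by simp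
qed

lemma diagonal_cone_line: "{p. fst p = snd p} \<in> cone_lines"
  and antidiagonal_cone_line: "{p. fst p = - snd p} \<in> cone_lines"
  by (auto simp: cone_lines_def)

lemma model_slope_pos_domain:
  assumes "\<alpha> > -1" "s > 0"
  shows "model_slope \<alpha> c s + 1 = - (exp (- 2 * ((\<alpha> + 1) * s)) * (2 / (1 - exp (- 2 * ((\<alpha> + 1) * s)))))"
    "model_slope \<alpha> c s = - (cosh ((\<alpha> + 1) * s) / sinh ((\<alpha> + 1) * s))"
proof -
  show "model_slope \<alpha> c s = - (cosh ((\<alpha> + 1) * s) / sinh ((\<alpha> + 1) * s))"
    using assms by (simp add: model_slope_def)
  then show "model_slope \<alpha> c s + 1 = - (exp (- 2 * ((\<alpha> + 1) * s)) * (2 / (1 - exp (- 2 * ((\<alpha> + 1) * s)))))"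
    using coth_minus_1[of "(\<alpha> + 1) * s"] assms by simp
qed

text \<open>Writes the velocity as a positive factor times a vector \<open>W\<close> with a limit; \<open>W\<close> is given by
  its null coordinates and \<open>e\<close> is chosen to be the dominant exponential.\<close>

lemma velocity_eq_scaleRI:
  assumes "s \<in> model_domain \<alpha>" "e > 0"
    and "fst W + snd W = exp s / e * (model_slope \<alpha> c s + 1)"
    and "fst W - snd W = exp (- s) / e * (model_slope \<alpha> c s - 1)"
  shows "velocity (model_curve \<alpha> c) s = (model_radius \<alpha> c s * e) *\<^sub>R W"
proof -
  let ?V = "velocity (model_curve \<alpha> c) s" and ?r = "model_radius \<alpha> c s * e"
  have "fst ?V + snd ?V = ?r * (fst W + snd W)" "fst ?V - snd ?V = ?r * (fst W - snd W)"
    unfolding assms(3,4) velocity_null_coordinates[OF assms(1)] using assms(2) by simp_all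
  then have "fst ?V = ?r * fst W" "snd ?V = ?r * snd W"
    unfolding ring_distribs by linarith+
  then show ?thesis by (simp add: prod_eq_iff)
qed

text \<open>At the end at infinity the null coordinates of the velocity are to leading order
  \<open>-2e\<^bsup>-2as\<^esup>\<close> and \<open>-2e\<^bsup>-2s\<^esup>\<close>, with \<open>a = \<alpha> + 1\<close>, up to a common factor: which of them dominates
  depends on whether \<open>a\<close> exceeds \<open>1\<close>.\<close>

lemma model_curve_orthogonal_to_cone:
  assumes \<alpha>: "\<alpha> > 0"
  shows "\<exists>p. p \<noteq> 0 \<and> goes_to_point_orthogonally_to_cone (model_curve \<alpha> c) at_top p"
proof -
  obtain b where b: "b > 0" "(model_curve \<alpha> c \<longlongrightarrow> (b, b)) at_top"
    using model_curve_tendsto_cone_point[of \<alpha>] \<alpha> by auto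
  define a where "a = \<alpha> + 1"
  have a: "a > 0" using \<alpha> by (simp add: a_def)
  define P where "P s = - (exp (- (2 * \<alpha>) * s) * (2 / (1 - exp (- 2 * (a * s)))))" for s
  define M where "M s = - (cosh (a * s) / sinh (a * s)) - 1" for s
  have P: "(P \<longlongrightarrow> - (0 * 2)) at_top"
    unfolding P_def[abs_def] by (intro tendsto_intros tendsto_exp_neg_mult tendsto_coth(2) a) (use \<alpha> in simp)
  have M: "(M \<longlongrightarrow> - 1 - 1) at_top"
    unfolding M_def[abs_def] by (intro tendsto_intros tendsto_coth(1) a)
  define W where "W s = ((P s + M s) / 2, (P s - M s) / 2)" for s
  have W: "(W \<longlongrightarrow> (-1, 1)) at_top"
  proof -
    have "((\<lambda>s. ((P s + M s) / 2, (P s - M s) / 2)) \<longlongrightarrow>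
        ((- (0 * 2) + (- 1 - 1)) / 2, (- (0 * 2) - (- 1 - 1)) / 2)) at_top"
      by (intro tendsto_intros P M) auto
    then show ?thesis by (simp add: W_def[abs_def])
  qed
  have "tangent_direction_tends_to (model_curve \<alpha> c) at_top (sgn (-1, 1))"
  proof (rule tangent_direction_tends_to_sgn[OF _ W])
    show "\<forall>\<^sub>F s in at_top. 0 < model_radius \<alpha> c s * exp (- s) \<and>
        velocity (model_curve \<alpha> c) s = (model_radius \<alpha> c s * exp (- s)) *\<^sub>R W s"
      using eventually_gt_at_top[of "0::real"]
    proof eventually_elim
      case (elim s)
      have dom: "s \<in> model_domain \<alpha>" using elim \<alpha> by (simp add: model_domain_pos)
      note r = model_radius_pos[OF dom, of c]
      note sl = model_slope_pos_domain[of \<alpha> s c, folded a_def]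
      have "exp s / exp (- s) * exp (- 2 * (a * s)) = exp (- (2 * \<alpha>) * s)"
        by (simp add: a_def algebra_simps flip: exp_diff exp_add)
      then have "P s = exp s / exp (- s) * (model_slope \<alpha> c s + 1)"
        using sl(1) \<alpha> elim by (simp add: P_def mult.assoc[symmetric])
      moreover have "M s = model_slope \<alpha> c s - 1"
        using sl(2) \<alpha> elim by (simp add: M_def)
      ultimately show ?case
        using r by (intro conjI velocity_eq_scaleRI[OF dom]) (simp_all add: W_def flip: add_divide_distrib diff_divide_distrib)
    qed
  qed (simp add: zero_prod_def)
  then have "goes_to_point_orthogonally_to_cone (model_curve \<alpha> c) at_top (b, b)"
    unfolding goes_to_point_orthogonally_to_cone_def
    by (intro conjI exI[of _ "sgn (-1, 1)"] bexI[OF _ diagonal_cone_line] b(2))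
       (simp_all add: light_cone_def lor_def orthogonal_def sgn_div_norm)
  then show ?thesis using b(1) by (intro exI[of _ "(b, b)"]) (auto simp: zero_prod_def)
qed

lemma model_curve_tangential_to_cone:
  assumes \<alpha>: "-1 < \<alpha>" "\<alpha> < 0"
  shows "\<exists>p. p \<noteq> 0 \<and> goes_to_point_tangentially_to_cone (model_curve \<alpha> c) at_top p"
proof -
  obtain b where b: "b > 0" "(model_curve \<alpha> c \<longlongrightarrow> (b, b)) at_top"
    using model_curve_tendsto_cone_point[of \<alpha>] \<alpha> by auto
  define a where "a = \<alpha> + 1"
  have a: "a > 0" using \<alpha> by (simp add: a_def)
  define P where "P s = - (2 / (1 - exp (- 2 * (a * s))))" for s
  define M where "M s = exp (- (- 2 * \<alpha>) * s) * (- (cosh (a * s) / sinh (a * s)) - 1)" for s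
  have P: "(P \<longlongrightarrow> - 2) at_top"
    unfolding P_def[abs_def] by (intro tendsto_intros tendsto_coth(2) a)
  have M: "(M \<longlongrightarrow> 0 * (- 1 - 1)) at_top"
    unfolding M_def[abs_def] by (intro tendsto_intros tendsto_exp_neg_mult tendsto_coth(1) a) (use \<alpha> in simp)
  define W where "W s = ((P s + M s) / 2, (P s - M s) / 2)" for s
  have W: "(W \<longlongrightarrow> (-1, -1)) at_top"
  proof -
    have "((\<lambda>s. ((P s + M s) / 2, (P s - M s) / 2)) \<longlongrightarrow>
        ((- 2 + 0 * (- 1 - 1)) / 2, (- 2 - 0 * (- 1 - 1)) / 2)) at_top"
      by (intro tendsto_intros P M) auto
    then show ?thesis by (simp add: W_def[abs_def])
  qed
  have "tangent_direction_tends_to (model_curve \<alpha> c) at_top (sgn (-1, -1))"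
  proof (rule tangent_direction_tends_to_sgn[OF _ W])
    show "\<forall>\<^sub>F s in at_top. 0 < model_radius \<alpha> c s * exp (s - 2 * (a * s)) \<and>
        velocity (model_curve \<alpha> c) s = (model_radius \<alpha> c s * exp (s - 2 * (a * s))) *\<^sub>R W s"
      using eventually_gt_at_top[of "0::real"]
    proof eventually_elim
      case (elim s)
      have dom: "s \<in> model_domain \<alpha>" using elim \<alpha> by (simp add: model_domain_pos)
      note r = model_radius_pos[OF dom, of c]
      note sl = model_slope_pos_domain[of \<alpha> s c, folded a_def]
      have "exp s = exp (s - 2 * (a * s)) / exp (- 2 * (a * s))"
        by (simp flip: exp_diff)
      then have "P s = exp s / exp (s - 2 * (a * s)) * (model_slope \<alpha> c s + 1)"
        using sl(1) \<alpha> elim by (simp add: P_def)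
      moreover have "exp (- s) / exp (s - 2 * (a * s)) = exp (- (- 2 * \<alpha>) * s)"
        by (simp add: a_def algebra_simps flip: exp_diff exp_add)
      then have "M s = exp (- s) / exp (s - 2 * (a * s)) * (model_slope \<alpha> c s - 1)"
        using sl(2) \<alpha> elim by (simp add: M_def)
      ultimately show ?case
        using r by (intro conjI velocity_eq_scaleRI[OF dom]) (simp_all add: W_def flip: add_divide_distrib diff_divide_distrib)
    qed
  qed (simp add: zero_prod_def)
  then have "goes_to_point_tangentially_to_cone (model_curve \<alpha> c) at_top (b, b)"
    unfolding goes_to_point_tangentially_to_cone_def
    by (intro conjI exI[of _ "sgn (-1, -1)"] bexI[OF _ diagonal_cone_line] b(2))
       (simp_all add: light_cone_def lor_def sgn_div_norm)
  then show ?thesis using b(1) by (intro exI[of _ "(b, b)"]) (auto simp: zero_prod_def)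
qed

text \<open>The null coordinates of the velocity are \<open>(c \<plusminus> 1) exp ((c \<plusminus> 1) s)\<close>. Both exponents have the sign
  of \<open>c\<close>; at the end where the curve tends to the origin the exponent of smaller absolute value dominates, and
  the corresponding null direction is the limit.\<close>

lemma exp_curve_tangential_to_cone:
  assumes c: "c\<^sup>2 > 1"
  shows "\<exists>E\<in>ends UNIV. goes_to_point_tangentially_to_cone (model_curve (-1) c) E 0"
proof -
  have r: "model_radius (-1) c s = exp (c * s)" "model_slope (-1) c s = c" "s \<in> model_domain (-1)" for s
    by (simp_all add: model_radius_def model_slope_def model_domain_def)
  \<comment> \<open>The end is the one at which \<open>\<tau>s\<close> tends to infinity, where \<open>\<tau>\<close> is the sign opposite to that of \<open>c\<close>.\<close>
  have main: "goes_to_point_tangentially_to_cone (model_curve (-1) c) E 0"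
    if \<tau>: "\<tau> = 1 \<or> \<tau> = -1" "\<tau> * c < -1" and E: "filterlim (\<lambda>s. \<tau> * s) at_top E" for \<tau> E
  proof -
    have lim: "((\<lambda>s. exp (- b * (\<tau> * s))) \<longlongrightarrow> 0) E" if "b > 0" for b
      using filterlim_compose[OF tendsto_exp_neg_mult[OF that] E] .
    have 1: "((\<lambda>s. exp (c * s) * exp (\<tau> * s)) \<longlongrightarrow> 0) E"
    proof -
      have "- (- (\<tau> * c) - 1) * (\<tau> * s) = c * s + \<tau> * s" for s using \<tau>(1) by (auto simp: algebra_simps)
      then show ?thesis using lim[of "- (\<tau> * c) - 1"] \<tau>(2) by (simp add: exp_add)
    qed
    have 2: "((\<lambda>s. exp (c * s) * exp (- (\<tau> * s))) \<longlongrightarrow> 0) E"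
    proof -
      have "- (- (\<tau> * c) + 1) * (\<tau> * s) = c * s + - (\<tau> * s)" for s using \<tau>(1) by (auto simp: algebra_simps)
      then show ?thesis using lim[of "- (\<tau> * c) + 1"] \<tau>(2) by (simp only: exp_add)
    qed
    have "(model_curve (-1) c \<longlongrightarrow> ((0 + 0) / 2, (0 - 0) / 2)) E"
      using \<tau>(1) 1 2 by (intro tendsto_from_null_coordinates) (auto simp: model_curve_null_coordinates r)
    then have lim0: "(model_curve (-1) c \<longlongrightarrow> 0) E" by (simp add: zero_prod_def)
    define W where "W s = ((c + \<tau> + exp (- 2 * (\<tau> * s)) * (c - \<tau>)) / 2, \<tau> * (c + \<tau> - exp (- 2 * (\<tau> * s)) * (c - \<tau>)) / 2)" for s
    have "(W \<longlongrightarrow> ((c + \<tau> + 0 * (c - \<tau>)) / 2, \<tau> * (c + \<tau> - 0 * (c - \<tau>)) / 2)) E"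
      unfolding W_def[abs_def] by (intro tendsto_intros lim) auto
    then have W: "(W \<longlongrightarrow> ((c + \<tau>) / 2, \<tau> * (c + \<tau>) / 2)) E" by simp
    have vel: "velocity (model_curve (-1) c) s = (model_radius (-1) c s * exp (\<tau> * s)) *\<^sub>R W s" for s
    proof (rule velocity_eq_scaleRI[OF r(3)])
      have e: "exp (- 2 * (\<tau> * s)) = exp (- (\<tau> * s)) / exp (\<tau> * s)" by (simp flip: exp_diff)
      show "fst (W s) + snd (W s) = exp s / exp (\<tau> * s) * (model_slope (-1) c s + 1)"
        "fst (W s) - snd (W s) = exp (- s) / exp (\<tau> * s) * (model_slope (-1) c s - 1)"
        using \<tau>(1) unfolding W_def e r(2) by (auto simp: field_simps)
    qed simp
    have nz: "c + \<tau> \<noteq> 0" using \<tau> by auto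
    have "tangent_direction_tends_to (model_curve (-1) c) E (sgn ((c + \<tau>) / 2, \<tau> * (c + \<tau>) / 2))"
      by (rule tangent_direction_tends_to_sgn[OF _ W, of "\<lambda>s. model_radius (-1) c s * exp (\<tau> * s)"])
         (use nz vel in \<open>auto simp: zero_prod_def r(1)\<close>)
    moreover have "\<exists>L\<in>cone_lines. 0 \<in> L \<and> sgn ((c + \<tau>) / 2, \<tau> * (c + \<tau>) / 2) \<in> L"
    proof -
      define n where "n = inverse (norm ((c + \<tau>) / 2, \<tau> * (c + \<tau>) / 2))"
      have "sgn ((c + \<tau>) / 2, \<tau> * (c + \<tau>) / 2) = (n * ((c + \<tau>) / 2), \<tau> * (n * ((c + \<tau>) / 2)))"
        by (simp add: sgn_div_norm n_def)
      moreover have "\<exists>L\<in>cone_lines. 0 \<in> L \<and> (x, \<tau> * x) \<in> L" for x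
        using \<tau>(1)
      proof
        assume "\<tau> = 1"
        then show ?thesis by (intro bexI[OF _ diagonal_cone_line]) simp
      next
        assume "\<tau> = -1"
        then show ?thesis by (intro bexI[OF _ antidiagonal_cone_line]) simp
      qed
      ultimately show ?thesis by (simp only:)
    qed
    moreover have "0 \<in> light_cone" by (simp add: light_cone_def lor_simps)
    ultimately show ?thesis
      using lim0 unfolding goes_to_point_tangentially_to_cone_def by blast
  qed
  have "c > 1 \<or> c < -1" using c abs_square_le_1[of c] by linarith
  then show ?thesis
  proof
    assume "c > 1"
    then have "goes_to_point_tangentially_to_cone (model_curve (-1) c) at_bot 0"
      using main[of "-1" at_bot] filterlim_uminus_at_top_at_bot by simp
    then show ?thesis by (auto simp: ends_UNIV)
  next
    assume "c < -1"
    then have "goes_to_point_tangentially_to_cone (model_curve (-1) c) at_top 0"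
      using main[of 1 at_top] by (simp add: filterlim_ident)
    then show ?thesis by (auto simp: ends_UNIV)
  qed
qed

lemma filterlim_norm_fst_at_infinity:
  fixes F :: "'a \<Rightarrow> real \<times> real"
  assumes "filterlim g at_top E" "\<forall>\<^sub>F s in E. g s \<le> fst (F s)"
  shows "filterlim F at_infinity E"
proof (rule filterlim_norm_at_top_imp_at_infinity, rule filterlim_at_top_mono[OF assms(1)])
  show "\<forall>\<^sub>F s in E. g s \<le> norm (F s)"
    using assms(2)
  proof eventually_elim
    case (elim s)
    then show ?case
      using norm_fst_le[of "fst (F s)" "snd (F s)"] by simp
  qed
qed

lemma tendsto_sinh_mult_0: "((\<lambda>s. sinh (b * s)) \<longlongrightarrow> (0::real)) (at 0 within S)"
proof -
  have "((\<lambda>s. sinh (b * s)) \<longlongrightarrow> sinh (b * 0)) (at 0 within S)"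
    by (intro tendsto_intros)
  then show ?thesis by simp
qed

text \<open>The radius tends to infinity only like \<open>s powr (- 1 / a)\<close> with \<open>a = \<alpha> + 1 > 1\<close>, so the
  height \<open>\<rho> sinh s\<close> still tends to zero.\<close>

lemma model_curve_asymptotic_to_x_axis:
  assumes \<alpha>: "\<alpha> > 0"
  shows "asymptotic_to_line (model_curve \<alpha> c) (at_right 0) x_axis"
proof -
  define a where "a = \<alpha> + 1"
  have a: "a > 1" using \<alpha> by (simp add: a_def)
  have \<rho>: "model_radius \<alpha> c s = inverse (sinh (a * s) powr (1 / a))" for s
    using \<alpha> by (simp add: model_radius_def a_def powr_minus)
  have pos: "\<forall>\<^sub>F s in at_right 0. s > (0::real)"
    by (simp add: eventually_at_right_less)
  show ?thesis
  proof (rule asymptotic_to_lineI[where p = "\<lambda>s. (fst (model_curve \<alpha> c s), 0)"])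
    show "filterlim (model_curve \<alpha> c) at_infinity (at_right 0)"
    proof (rule filterlim_norm_fst_at_infinity)
      have "((\<lambda>s. sinh (a * s) powr (1 / a)) \<longlongrightarrow> 0) (at_right 0)"
        using pos a
        by (intro tendsto_zero_powrI[OF tendsto_sinh_mult_0 tendsto_const]) (auto elim: eventually_mono)
      moreover have "\<forall>\<^sub>F s in at_right 0. sinh (a * s) powr (1 / a) > 0"
        using pos by eventually_elim (use a in auto)
      ultimately show "filterlim (model_radius \<alpha> c) at_top (at_right 0)"
        unfolding \<rho> by (rule filterlim_inverse_at_top)
      have "model_radius \<alpha> c s * 1 \<le> model_radius \<alpha> c s * cosh s" for s
        by (intro mult_left_mono cosh_real_ge_1) (simp add: \<rho>)
      then show "\<forall>\<^sub>F s in at_right 0. model_radius \<alpha> c s \<le> fst (model_curve \<alpha> c s)"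
        by (simp add: model_curve_def)
    qed
    have lim: "((\<lambda>s. sinh (1 * s) powr (1 - 1 / a)) \<longlongrightarrow> 0) (at_right 0)"
      using pos a
      by (intro tendsto_zero_powrI[OF tendsto_sinh_mult_0 tendsto_const]) (auto elim: eventually_mono)
    have "((\<lambda>s. snd (model_curve \<alpha> c s)) \<longlongrightarrow> 0) (at_right 0)"
    proof (rule tendsto_sandwich[OF _ _ tendsto_const lim])
      show "\<forall>\<^sub>F s in at_right 0. 0 \<le> snd (model_curve \<alpha> c s)"
        using pos by eventually_elim (simp add: model_curve_def \<rho>)
      show "\<forall>\<^sub>F s in at_right 0. snd (model_curve \<alpha> c s) \<le> sinh (1 * s) powr (1 - 1 / a)"
        using pos
      proof eventually_elim
        case (elim s)
        have "sinh s \<le> sinh (a * s)" using elim a by simp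
        then have "sinh s powr (1 / a) \<le> sinh (a * s) powr (1 / a)"
          using elim a by (intro powr_mono2) auto
        then have "sinh s / sinh (a * s) powr (1 / a) \<le> sinh s / sinh s powr (1 / a)"
          using elim a by (intro divide_left_mono mult_pos_pos) auto
        also have "\<dots> = sinh s powr (1 - 1 / a)" using elim by (simp add: powr_diff)
        finally show ?case by (simp add: model_curve_def \<rho> field_simps)
      qed
    qed
    then have "((\<lambda>s. (0, snd (model_curve \<alpha> c s))) \<longlongrightarrow> (0, 0)) (at_right 0)"
      by (intro tendsto_intros)
    moreover have "(\<lambda>s. model_curve \<alpha> c s - (fst (model_curve \<alpha> c s), 0)) = (\<lambda>s. (0, snd (model_curve \<alpha> c s)))"
      by (simp add: fun_eq_iff prod_eq_iff)
    ultimately show "((\<lambda>s. model_curve \<alpha> c s - (fst (model_curve \<alpha> c s), 0)) \<longlongrightarrow> 0) (at_right 0)"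
      by (simp add: zero_prod_def)
  qed (simp add: x_axis_def)
qed

text \<open>The slope tends to minus infinity, so the velocity is dominated by its radial part, and the hyperbolic
  angle tends to zero.\<close>

lemma model_curve_to_origin_tangential_to_x_axis:
  assumes \<alpha>: "\<alpha> < -1"
  shows "goes_to_origin_tangentially_to_x_axis (model_curve \<alpha> c) (at_left 0)"
proof -
  define a where "a = \<alpha> + 1"
  have a: "a < 0" using \<alpha> by (simp add: a_def)
  have \<rho>: "model_radius \<alpha> c = (\<lambda>s. sinh (a * s) powr (-1 / a))"
    using \<alpha> by (simp add: fun_eq_iff model_radius_def a_def)
  have neg: "\<forall>\<^sub>F s in at_left 0. s < (0::real)"
    by (simp add: eventually_at_filter)
  have pos: "\<forall>\<^sub>F s in at_left 0. a * s > 0"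
    using neg by eventually_elim (use a in \<open>simp add: zero_less_mult_iff\<close>)
  have "(model_radius \<alpha> c \<longlongrightarrow> 0) (at_left 0)"
    unfolding \<rho> using pos a
    by (intro tendsto_zero_powrI[OF tendsto_sinh_mult_0 tendsto_const])
       (auto elim: eventually_mono simp: divide_neg_neg)
  moreover have "((\<lambda>s::real. (cosh s, sinh s)) \<longlongrightarrow> (cosh 0, sinh 0)) (at_left 0)"
    by (intro tendsto_intros)
  ultimately have "((\<lambda>s. model_radius \<alpha> c s *\<^sub>R (cosh s, sinh s)) \<longlongrightarrow> 0 *\<^sub>R (cosh 0, sinh 0)) (at_left 0)"
    by (rule tendsto_scaleR)
  then have lim: "(model_curve \<alpha> c \<longlongrightarrow> 0) (at_left 0)"
    by (simp add: model_curve_def[abs_def] zero_prod_def)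
  define W where "W s = (- cosh s + tanh (a * s) * sinh s, - sinh s + tanh (a * s) * cosh s)" for s
  have "(W \<longlongrightarrow> (- cosh 0 + tanh (a * 0) * sinh 0, - sinh 0 + tanh (a * 0) * cosh 0)) (at_left 0)"
    unfolding W_def[abs_def] by (intro tendsto_intros) auto
  then have W: "(W \<longlongrightarrow> (- 1, 0)) (at_left 0)" by simp
  define r where "r s = model_radius \<alpha> c s * (cosh (a * s) / sinh (a * s))" for s
  have "tangent_direction_tends_to (model_curve \<alpha> c) (at_left 0) (sgn (- 1, 0))"
  proof (rule tangent_direction_tends_to_sgn[OF _ W])
    show "\<forall>\<^sub>F s in at_left 0. 0 < r s \<and> velocity (model_curve \<alpha> c) s = r s *\<^sub>R W s"
      using neg pos
    proof eventually_elim
      case (elim s)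
      have dom: "s \<in> model_domain \<alpha>" using elim \<alpha> by (simp add: model_domain_neg)
      have S: "sinh (a * s) > 0" "cosh (a * s) > 0" using elim by auto
      define q where "q = cosh (a * s) / sinh (a * s)"
      have q: "q * tanh (a * s) = 1" using S by (auto simp: q_def tanh_def)
      have w: "model_slope \<alpha> c s = - q"
        using \<alpha> by (simp add: model_slope_def a_def q_def)
      have "r s *\<^sub>R W s = model_radius \<alpha> c s *\<^sub>R
          (- q * cosh s + (q * tanh (a * s)) * sinh s, - q * sinh s + (q * tanh (a * s)) * cosh s)"
        by (simp add: r_def W_def q_def[symmetric] algebra_simps)
      then have "r s *\<^sub>R W s = model_radius \<alpha> c s *\<^sub>R
          (model_slope \<alpha> c s * cosh s + sinh s, model_slope \<alpha> c s * sinh s + cosh s)"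
        by (simp only: q w mult_1_left)
      moreover have "r s > 0"
        using model_radius_pos[OF dom, of c] S unfolding r_def by simp
      ultimately show ?case by (simp add: velocity_model_curve[OF dom])
    qed
  qed (simp add: zero_prod_def)
  moreover have "sgn (- 1, 0) \<in> x_axis"
    by (simp add: x_axis_def sgn_div_norm)
  ultimately show ?thesis
    using lim by (auto simp: goes_to_origin_tangentially_to_x_axis_def)
qed

text \<open>Here \<open>\<rho>\<close> grows like a constant times \<open>exp (- s)\<close>, so \<open>x + y = \<rho> exp s\<close> has a limit
  \<open>\<kappa>\<close> and the curve approaches the line \<open>x + y = \<kappa>\<close>, while \<open>x - y\<close> tends to infinity.\<close>

lemma model_curve_asymptotic_to_translated_cone:
  assumes \<alpha>: "\<alpha> < -1"
  shows "asymptotic_to_translated_cone (model_curve \<alpha> c) at_bot"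
proof -
  define a where "a = \<alpha> + 1"
  have a: "a < 0" using \<alpha> by (simp add: a_def)
  define k where "k s = ((1 - exp (- 2 * (a * s))) / 2) powr (-1 / a)" for s
  define \<kappa> where "\<kappa> = (1/2 :: real) powr (-1 / a)"
  have as: "filterlim (\<lambda>s. a * s) at_top at_bot"
    using filterlim_tendsto_pos_mult_at_top[OF tendsto_const _ filterlim_uminus_at_top_at_bot, of "- a"] a by simp
  have k: "(k \<longlongrightarrow> \<kappa>) at_bot"
    unfolding k_def[abs_def] \<kappa>_def by (rule tendsto_sinh_factor[OF as])
  have \<rho>: "model_radius \<alpha> c s = exp (- s) * k s" if "s < 0" for s
  proof -
    have "a * s > 0" using a that by (rule mult_neg_neg)
    from sinh_powr_exp[OF this, of "-1 / a"] show ?thesis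
      using \<alpha> a by (simp add: model_radius_def k_def flip: a_def)
  qed
  have k_pos: "k s > 0" if "s < 0" for s
    using mult_neg_neg[OF a that] by (auto simp: k_def)
  have lim: "((\<lambda>s. fst (model_curve \<alpha> c s) + snd (model_curve \<alpha> c s)) \<longlongrightarrow> \<kappa>) at_bot"
  proof (rule Lim_transform_eventually[OF k])
    show "\<forall>\<^sub>F s in at_bot. k s = fst (model_curve \<alpha> c s) + snd (model_curve \<alpha> c s)"
      using eventually_gt_at_bot[of "0::real"]
      by eventually_elim (simp add: model_curve_null_coordinates \<rho> exp_minus)
  qed
  have "asymptotic_to_line (model_curve \<alpha> c) at_bot ((+) (\<kappa>, 0) ` {p. fst p = - snd p})"
  proof (rule asymptotic_to_lineI[where p = "\<lambda>s. (\<kappa>, 0) + (- snd (model_curve \<alpha> c s), snd (model_curve \<alpha> c s))"])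
    show "filterlim (model_curve \<alpha> c) at_infinity at_bot"
    proof (rule filterlim_norm_fst_at_infinity)
      have "filterlim (\<lambda>s::real. 2 * (- s)) at_top at_bot"
        by (rule filterlim_tendsto_pos_mult_at_top[OF tendsto_const _ filterlim_uminus_at_top_at_bot]) simp
      then have "filterlim (\<lambda>s::real. exp (2 * (- s))) at_top at_bot"
        by (rule filterlim_compose[OF exp_at_top])
      moreover have "((\<lambda>s. k s / 2) \<longlongrightarrow> \<kappa> / 2) at_bot"
        by (intro tendsto_intros k) auto
      ultimately show "filterlim (\<lambda>s. k s / 2 * exp (2 * (- s))) at_top at_bot"
        by (intro filterlim_tendsto_pos_mult_at_top) (auto simp: \<kappa>_def)
      show "\<forall>\<^sub>F s in at_bot. k s / 2 * exp (2 * (- s)) \<le> fst (model_curve \<alpha> c s)"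
        using eventually_gt_at_bot[of "0::real"]
      proof eventually_elim
        case (elim s)
        have "exp (2 * (- s)) = exp (- s) * exp (- s)" by (simp flip: exp_add)
        then have "fst (model_curve \<alpha> c s) - snd (model_curve \<alpha> c s) = k s * exp (2 * (- s))"
          by (simp add: model_curve_null_coordinates \<rho>[OF elim])
        moreover have "fst (model_curve \<alpha> c s) + snd (model_curve \<alpha> c s) > 0"
          using k_pos[OF elim] by (simp add: model_curve_null_coordinates \<rho>[OF elim])
        ultimately show ?case by simp
      qed
    qed
    have "((\<lambda>s. (fst (model_curve \<alpha> c s) + snd (model_curve \<alpha> c s) - \<kappa>, 0::real)) \<longlongrightarrow> (\<kappa> - \<kappa>, 0)) at_bot"
      by (intro tendsto_intros lim)
    moreover have "model_curve \<alpha> c s - ((\<kappa>, 0) + (- snd (model_curve \<alpha> c s), snd (model_curve \<alpha> c s))) =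
        (fst (model_curve \<alpha> c s) + snd (model_curve \<alpha> c s) - \<kappa>, 0)" for s
      by (simp add: prod_eq_iff)
    ultimately show "((\<lambda>s. model_curve \<alpha> c s - ((\<kappa>, 0) + (- snd (model_curve \<alpha> c s), snd (model_curve \<alpha> c s)))) \<longlongrightarrow> 0) at_bot"
      by (simp add: zero_prod_def)
  qed (intro imageI, simp)
  then show ?thesis
    using antidiagonal_cone_line unfolding asymptotic_to_translated_cone_def by blast
qed

section \<open>The classification\<close>

theorem theorem4p3:
  fixes \<alpha> :: real
  shows
    "(\<forall>\<beta> I. (spacelike_curve \<beta> I \<and> stationary_curve \<alpha> \<beta> I \<and> \<beta> ` I \<subseteq> cone_plus \<and>
              \<not> radial_line_contains \<beta> I)
         \<longleftrightarrow>
           (\<exists>c A d h J. (\<alpha> = -1 \<longrightarrow> c\<^sup>2 > 1) \<and> linear_isometry A \<and> dilation d \<and>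
              J \<subseteq> model_domain \<alpha> \<and> change_of_parameter h I J \<and>
              (\<forall>t\<in>I. \<beta> t = d (A (model_curve \<alpha> c (h t)))))) \<and>
     (\<forall>c. (\<alpha> = -1 \<longrightarrow> c\<^sup>2 > 1) \<longrightarrow>
        (\<alpha> > 0 \<longrightarrow>
           (\<exists>E E'. ends (model_domain \<alpha>) = {E, E'} \<and>
              (\<exists>p. p \<noteq> 0 \<and> goes_to_point_orthogonally_to_cone (model_curve \<alpha> c) E p) \<and>
              asymptotic_to_line (model_curve \<alpha> c) E' x_axis)) \<and>
        (-1 < \<alpha> \<and> \<alpha> < 0 \<longrightarrow>
           (\<exists>E\<in>ends (model_domain \<alpha>). \<exists>p. p \<noteq> 0 \<and>
              goes_to_point_tangentially_to_cone (model_curve \<alpha> c) E p)) \<and>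
        (\<alpha> = -1 \<longrightarrow>
           (\<exists>E\<in>ends (model_domain \<alpha>).
              goes_to_point_tangentially_to_cone (model_curve \<alpha> c) E 0)) \<and>
        (\<alpha> < -1 \<longrightarrow>
           (\<exists>E E'. ends (model_domain \<alpha>) = {E, E'} \<and>
              goes_to_origin_tangentially_to_x_axis (model_curve \<alpha> c) E \<and>
              asymptotic_to_translated_cone (model_curve \<alpha> c) E')))"
proof (intro conjI allI impI)
  fix \<beta> :: "real \<Rightarrow> real \<times> real" and I
  let ?model = "\<lambda>c A d h J. (\<alpha> = -1 \<longrightarrow> c\<^sup>2 > 1) \<and> linear_isometry A \<and> dilation d \<and>
    J \<subseteq> model_domain \<alpha> \<and> change_of_parameter h I J \<and>
    (\<forall>t\<in>I. \<beta> t = d (A (model_curve \<alpha> c (h t))))"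
  show "(spacelike_curve \<beta> I \<and> stationary_curve \<alpha> \<beta> I \<and> \<beta> ` I \<subseteq> cone_plus \<and>
      \<not> radial_line_contains \<beta> I) \<longleftrightarrow> (\<exists>c A d h J. ?model c A d h J)"
  proof (intro iffI; elim conjE exE)
    assume "spacelike_curve \<beta> I" "stationary_curve \<alpha> \<beta> I" "\<beta> ` I \<subseteq> cone_plus"
      "\<not> radial_line_contains \<beta> I"
    then show "\<exists>c A d h J. ?model c A d h J"
      by (rule stationary_imp_transformed_model_curve)
  next
    fix c A d h J
    assume "\<alpha> = -1 \<longrightarrow> c\<^sup>2 > 1" "linear_isometry A" "dilation d" "J \<subseteq> model_domain \<alpha>"
      "change_of_parameter h I J" "\<forall>t\<in>I. \<beta> t = d (A (model_curve \<alpha> c (h t)))"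
    note model = transformed_model_curve_stationary[OF mp[OF this(1)] this(2-5) bspec[OF this(6)]]
    show "spacelike_curve \<beta> I \<and> stationary_curve \<alpha> \<beta> I \<and> \<beta> ` I \<subseteq> cone_plus \<and>
        \<not> radial_line_contains \<beta> I"
      by (intro conjI model)
  qed
next
  fix c :: real assume "\<alpha> > 0"
  then have "ends (model_domain \<alpha>) = {at_top, at_right 0}"
    by (simp add: model_domain_pos ends_greaterThan insert_commute)
  then show "\<exists>E E'. ends (model_domain \<alpha>) = {E, E'} \<and>
      (\<exists>p. p \<noteq> 0 \<and> goes_to_point_orthogonally_to_cone (model_curve \<alpha> c) E p) \<and>
      asymptotic_to_line (model_curve \<alpha> c) E' x_axis"
    using model_curve_orthogonal_to_cone[OF \<open>\<alpha> > 0\<close>] model_curve_asymptotic_to_x_axis[OF \<open>\<alpha> > 0\<close>]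
    by blast
next
  fix c :: real assume "-1 < \<alpha> \<and> \<alpha> < 0"
  then show "\<exists>E\<in>ends (model_domain \<alpha>). \<exists>p. p \<noteq> 0 \<and>
      goes_to_point_tangentially_to_cone (model_curve \<alpha> c) E p"
    using model_curve_tangential_to_cone[of \<alpha> c] by (auto simp: model_domain_pos ends_greaterThan)
next
  fix c :: real assume "\<alpha> = -1 \<longrightarrow> c\<^sup>2 > 1" "\<alpha> = -1"
  then show "\<exists>E\<in>ends (model_domain \<alpha>). goes_to_point_tangentially_to_cone (model_curve \<alpha> c) E 0"
    using exp_curve_tangential_to_cone[of c] by (simp add: model_domain_def)
next
  fix c :: real assume "\<alpha> < -1"
  then have "ends (model_domain \<alpha>) = {at_left 0, at_bot}"
    by (simp add: model_domain_neg ends_lessThan insert_commute)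
  then show "\<exists>E E'. ends (model_domain \<alpha>) = {E, E'} \<and>
      goes_to_origin_tangentially_to_x_axis (model_curve \<alpha> c) E \<and>
      asymptotic_to_translated_cone (model_curve \<alpha> c) E'"
    using model_curve_to_origin_tangential_to_x_axis[OF \<open>\<alpha> < -1\<close>]
      model_curve_asymptotic_to_translated_cone[OF \<open>\<alpha> < -1\<close>]
    by blast
qed

end
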